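(* Let $R$ be a regular ring and let $M$ be a maximal ideal of $R$. Then $M$ is a big ideal.
   Context: All rings are commutative with identity $1\neq 0$. A regular ring is a Noetherian ring all of whose localizations at prime ideals are regular local rings. An ideal $J$ of a ring $R$ is called a big ideal if for every ideal $I\subsetneq J$ one has $I^n\subsetneq J^n$ for all $n\geq 1$. *)

theory Defs
  imports "HOL-Algebra.Algebra" "HOL-Library.Extended_Nat"
begin

section \<open>Rings of fractions\<close>

definition frac_rel :: "('a, 'b) ring_scheme \<Rightarrow> 'a set \<Rightarrow> (('a \<times> 'a) \<times> ('a \<times> 'a)) set"
  where "frac_rel R S =
    {((a, s), (b, t)). a \<in> carrier R \<and> b \<in> carrier R \<and> s \<in> S \<and> t \<in> S \<and>
       (\<exists>u\<in>S. u \<otimes>\<^bsub>R\<^esub> (a \<otimes>\<^bsub>R\<^esub> t \<ominus>\<^bsub>R\<^esub> b \<otimes>\<^bsub>R\<^esub> s) = \<zero>\<^bsub>R\<^esub>)}"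

definition fraction :: "('a, 'b) ring_scheme \<Rightarrow> 'a set \<Rightarrow> 'a \<Rightarrow> 'a \<Rightarrow> ('a \<times> 'a) set"
  where "fraction R S a s = frac_rel R S `` {(a, s)}"

text \<open>
  The operations on classes take the union over all choices of representatives; the lemmas
  \<open>mult_fraction\<close> and \<open>add_fraction\<close> below show that all choices give the same class.
\<close>

definition fraction_ring :: "('a, 'b) ring_scheme \<Rightarrow> 'a set \<Rightarrow> ('a \<times> 'a) set ring"
  where "fraction_ring R S =
    \<lparr> carrier = (carrier R \<times> S) // frac_rel R S,
      monoid.mult = (\<lambda>A B. \<Union>(a, s)\<in>A. \<Union>(b, t)\<in>B. fraction R S (a \<otimes>\<^bsub>R\<^esub> b) (s \<otimes>\<^bsub>R\<^esub> t)),
      one = fraction R S \<one>\<^bsub>R\<^esub> \<one>\<^bsub>R\<^esub>,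
      ring.zero = fraction R S \<zero>\<^bsub>R\<^esub> \<one>\<^bsub>R\<^esub>,
      ring.add = (\<lambda>A B. \<Union>(a, s)\<in>A. \<Union>(b, t)\<in>B.
               fraction R S (a \<otimes>\<^bsub>R\<^esub> t \<oplus>\<^bsub>R\<^esub> b \<otimes>\<^bsub>R\<^esub> s) (s \<otimes>\<^bsub>R\<^esub> t)) \<rparr>"

definition localization_at :: "('a, 'b) ring_scheme \<Rightarrow> 'a set \<Rightarrow> ('a \<times> 'a) set ring"
  where "localization_at R P = fraction_ring R (carrier R - P)"

context cring
begin

lemma frac_rel_iff:
  assumes "submonoid S R"
  shows "((a, s), (b, t)) \<in> frac_rel R S \<longleftrightarrow>
    a \<in> carrier R \<and> b \<in> carrier R \<and> s \<in> S \<and> t \<in> S \<and> (\<exists>u\<in>S. u \<otimes> (a \<otimes> t) = u \<otimes> (b \<otimes> s))"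
proof -
  interpret S: submonoid S R by fact
  have "u \<otimes> (a \<otimes> t \<ominus> b \<otimes> s) = \<zero> \<longleftrightarrow> u \<otimes> (a \<otimes> t) = u \<otimes> (b \<otimes> s)"
    if "a \<in> carrier R" "b \<in> carrier R" "s \<in> S" "t \<in> S" "u \<in> S" for u
  proof -
    have "u \<in> carrier R" "s \<in> carrier R" "t \<in> carrier R"
      using that S.subset by auto
    moreover from this that have "u \<otimes> (a \<otimes> t \<ominus> b \<otimes> s) = u \<otimes> (a \<otimes> t) \<ominus> u \<otimes> (b \<otimes> s)"
      by (simp add: a_minus_def r_distr r_minus)
    ultimately show ?thesis
      using that by simp
  qed
  then show ?thesis
    unfolding frac_rel_def by auto
qed

lemma equiv_frac_rel:
  assumes "submonoid S R"
  shows "equiv (carrier R \<times> S) (frac_rel R S)"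
proof (rule equivI)
  interpret S: submonoid S R by fact
  note rel = frac_rel_iff[OF assms]
  show "frac_rel R S \<subseteq> (carrier R \<times> S) \<times> (carrier R \<times> S)"
    unfolding frac_rel_def by auto
  show "refl_on (carrier R \<times> S) (frac_rel R S)"
    using S.one_closed by (auto simp: refl_on_def rel)
  show "sym (frac_rel R S)"
    by (rule symI) (clarsimp simp: rel, metis)
  show "trans (frac_rel R S)"
  proof (rule transI, clarify)
    fix a s b t c r
    assume 1: "((a, s), (b, t)) \<in> frac_rel R S" and 2: "((b, t), (c, r)) \<in> frac_rel R S"
    obtain u where u: "u \<in> S" "u \<otimes> (a \<otimes> t) = u \<otimes> (b \<otimes> s)"
      using 1 by (auto simp: rel)
    obtain v where v: "v \<in> S" "v \<otimes> (b \<otimes> r) = v \<otimes> (c \<otimes> t)"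
      using 2 by (auto simp: rel)
    have inS: "s \<in> S" "t \<in> S" "r \<in> S" and abc: "a \<in> carrier R" "b \<in> carrier R" "c \<in> carrier R"
      using 1 2 by (auto simp: rel)
    have carr: "s \<in> carrier R" "t \<in> carrier R" "r \<in> carrier R" "u \<in> carrier R" "v \<in> carrier R"
      using inS u(1) v(1) S.subset by auto
    have "(u \<otimes> v \<otimes> t) \<otimes> (a \<otimes> r) = (v \<otimes> r) \<otimes> (u \<otimes> (a \<otimes> t))"
      using abc carr by (simp add: m_ac)
    also have "\<dots> = (u \<otimes> s) \<otimes> (v \<otimes> (b \<otimes> r))"
      unfolding u(2) using abc carr by (simp add: m_ac)
    also have "\<dots> = (u \<otimes> v \<otimes> t) \<otimes> (c \<otimes> s)"
      unfolding v(2) using abc carr by (simp add: m_ac)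
    finally show "((a, s), (c, r)) \<in> frac_rel R S"
      using inS abc u(1) v(1) by (auto simp: rel)
  qed
qed

lemma fraction_eq_iff:
  assumes "submonoid S R" "a \<in> carrier R" "s \<in> S" "b \<in> carrier R" "t \<in> S"
  shows "fraction R S a s = fraction R S b t \<longleftrightarrow> (\<exists>u\<in>S. u \<otimes> (a \<otimes> t) = u \<otimes> (b \<otimes> s))"
proof -
  have "fraction R S a s = fraction R S b t \<longleftrightarrow> ((a, s), (b, t)) \<in> frac_rel R S"
    unfolding fraction_def using eq_equiv_class_iff[OF equiv_frac_rel[OF assms(1)]] assms by simp
  then show ?thesis
    using assms by (simp add: frac_rel_iff)
qed

lemma fraction_op:
  assumes "submonoid S R" "a \<in> carrier R" "s \<in> S" "b \<in> carrier R" "t \<in> S"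
    and cong: "\<And>x y. ((a, s), x) \<in> frac_rel R S \<Longrightarrow> ((b, t), y) \<in> frac_rel R S \<Longrightarrow> f x y = f (a, s) (b, t)"
  shows "(\<Union>x\<in>fraction R S a s. \<Union>y\<in>fraction R S b t. f x y) = f (a, s) (b, t)"
proof -
  have "(a, s) \<in> fraction R S a s" "(b, t) \<in> fraction R S b t"
    using equiv_class_self[OF equiv_frac_rel[OF assms(1)]] assms unfolding fraction_def by auto
  moreover have "f x y = f (a, s) (b, t)" if "x \<in> fraction R S a s" "y \<in> fraction R S b t" for x y
    using that cong unfolding fraction_def by blast
  ultimately show ?thesis by blast
qed

lemma mult_fraction:
  assumes "submonoid S R" "a \<in> carrier R" "s \<in> S" "b \<in> carrier R" "t \<in> S"
  shows "fraction R S a s \<otimes>\<^bsub>fraction_ring R S\<^esub> fraction R S b t = fraction R S (a \<otimes> b) (s \<otimes> t)"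
proof -
  interpret S: submonoid S R by fact
  let ?f = "\<lambda>x y. case x of (a, s) \<Rightarrow> (case y of (b, t) \<Rightarrow> fraction R S (a \<otimes> b) (s \<otimes> t))"
  have "(\<Union>x\<in>fraction R S a s. \<Union>y\<in>fraction R S b t. ?f x y) = ?f (a, s) (b, t)"
  proof (rule fraction_op[OF assms], clarify)
    fix a' s' b' t'
    assume 1: "((a, s), (a', s')) \<in> frac_rel R S" and 2: "((b, t), (b', t')) \<in> frac_rel R S"
    obtain u where u: "u \<in> S" "u \<otimes> (a \<otimes> s') = u \<otimes> (a' \<otimes> s)"
      using 1 by (auto simp: frac_rel_iff[OF assms(1)])
    obtain v where v: "v \<in> S" "v \<otimes> (b \<otimes> t') = v \<otimes> (b' \<otimes> t)"
      using 2 by (auto simp: frac_rel_iff[OF assms(1)])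
    have inS: "s' \<in> S" "t' \<in> S" and ab: "a' \<in> carrier R" "b' \<in> carrier R"
      using 1 2 by (auto simp: frac_rel_iff[OF assms(1)])
    have carr: "s \<in> carrier R" "t \<in> carrier R" "s' \<in> carrier R" "t' \<in> carrier R"
      "u \<in> carrier R" "v \<in> carrier R"
      using inS u(1) v(1) S.subset assms by auto
    have "(u \<otimes> v) \<otimes> ((a' \<otimes> b') \<otimes> (s \<otimes> t)) = (u \<otimes> (a' \<otimes> s)) \<otimes> (v \<otimes> (b' \<otimes> t))"
      using ab carr by (simp add: m_ac)
    also have "\<dots> = (u \<otimes> v) \<otimes> ((a \<otimes> b) \<otimes> (s' \<otimes> t'))"
      unfolding u(2)[symmetric] v(2)[symmetric] using assms ab carr by (simp add: m_ac)
    finally show "fraction R S (a' \<otimes> b') (s' \<otimes> t') = fraction R S (a \<otimes> b) (s \<otimes> t)"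
      using u(1) v(1) inS ab assms by (subst fraction_eq_iff) auto
  qed
  then show ?thesis by (simp add: fraction_ring_def case_prod_unfold)
qed

lemma add_fraction:
  assumes "submonoid S R" "a \<in> carrier R" "s \<in> S" "b \<in> carrier R" "t \<in> S"
  shows "fraction R S a s \<oplus>\<^bsub>fraction_ring R S\<^esub> fraction R S b t = fraction R S (a \<otimes> t \<oplus> b \<otimes> s) (s \<otimes> t)"
proof -
  interpret S: submonoid S R by fact
  let ?f = "\<lambda>x y. case x of (a, s) \<Rightarrow> (case y of (b, t) \<Rightarrow> fraction R S (a \<otimes> t \<oplus> b \<otimes> s) (s \<otimes> t))"
  have "(\<Union>x\<in>fraction R S a s. \<Union>y\<in>fraction R S b t. ?f x y) = ?f (a, s) (b, t)"
  proof (rule fraction_op[OF assms], clarify)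
    fix a' s' b' t'
    assume 1: "((a, s), (a', s')) \<in> frac_rel R S" and 2: "((b, t), (b', t')) \<in> frac_rel R S"
    obtain u where u: "u \<in> S" "u \<otimes> (a \<otimes> s') = u \<otimes> (a' \<otimes> s)"
      using 1 by (auto simp: frac_rel_iff[OF assms(1)])
    obtain v where v: "v \<in> S" "v \<otimes> (b \<otimes> t') = v \<otimes> (b' \<otimes> t)"
      using 2 by (auto simp: frac_rel_iff[OF assms(1)])
    have inS: "s' \<in> S" "t' \<in> S" and ab: "a' \<in> carrier R" "b' \<in> carrier R"
      using 1 2 by (auto simp: frac_rel_iff[OF assms(1)])
    have carr: "s \<in> carrier R" "t \<in> carrier R" "s' \<in> carrier R" "t' \<in> carrier R"
      "u \<in> carrier R" "v \<in> carrier R"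
      using inS u(1) v(1) S.subset assms by auto
    have "(u \<otimes> v) \<otimes> ((a' \<otimes> t' \<oplus> b' \<otimes> s') \<otimes> (s \<otimes> t))
        = (u \<otimes> (a' \<otimes> s)) \<otimes> (v \<otimes> (t \<otimes> t')) \<oplus> (v \<otimes> (b' \<otimes> t)) \<otimes> (u \<otimes> (s \<otimes> s'))"
      using ab carr by (simp add: m_ac r_distr l_distr)
    also have "\<dots> = (u \<otimes> v) \<otimes> ((a \<otimes> t \<oplus> b \<otimes> s) \<otimes> (s' \<otimes> t'))"
      unfolding u(2)[symmetric] v(2)[symmetric]
      using assms ab carr by (simp add: m_ac r_distr l_distr)
    finally show "fraction R S (a' \<otimes> t' \<oplus> b' \<otimes> s') (s' \<otimes> t') = fraction R S (a \<otimes> t \<oplus> b \<otimes> s) (s \<otimes> t)"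
      using u(1) v(1) inS ab carr assms by (subst fraction_eq_iff) auto
  qed
  then show ?thesis by (simp add: fraction_ring_def case_prod_unfold)
qed

lemma fraction_carrierE:
  assumes "x \<in> carrier (fraction_ring R S)"
  obtains a s where "a \<in> carrier R" "s \<in> S" "x = fraction R S a s"
  using assms by (auto simp: fraction_ring_def quotient_def fraction_def)

lemma fraction_in_carrier:
  assumes "a \<in> carrier R" "s \<in> S"
  shows "fraction R S a s \<in> carrier (fraction_ring R S)"
  using assms by (auto simp: fraction_ring_def quotient_def fraction_def)

lemma fraction_ring_cring:
  assumes S: "submonoid S R"
  shows "cring (fraction_ring R S)"
proof -
  interpret S: submonoid S R by fact
  let ?F = "fraction_ring R S"
  have [simp]: "s \<in> carrier R" if "s \<in> S" for s using that S.subset by auto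
  have one: "\<one>\<^bsub>?F\<^esub> = fraction R S \<one> \<one>" and zero: "\<zero>\<^bsub>?F\<^esub> = fraction R S \<zero> \<one>"
    by (simp_all add: fraction_ring_def)
  note ops = mult_fraction[OF S] add_fraction[OF S] fraction_in_carrier one zero
  have eqI: "fraction R S a s = fraction R S b t"
    if "a \<in> carrier R" "s \<in> S" "b \<in> carrier R" "t \<in> S" "a \<otimes> t = b \<otimes> s" for a s b t
    using that fraction_eq_iff[OF S] S.one_closed by metis
  have assoc: "(x \<oplus>\<^bsub>?F\<^esub> y) \<oplus>\<^bsub>?F\<^esub> z = x \<oplus>\<^bsub>?F\<^esub> (y \<oplus>\<^bsub>?F\<^esub> z)"
    and distr: "(x \<oplus>\<^bsub>?F\<^esub> y) \<otimes>\<^bsub>?F\<^esub> z = x \<otimes>\<^bsub>?F\<^esub> z \<oplus>\<^bsub>?F\<^esub> y \<otimes>\<^bsub>?F\<^esub> z"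
    if xyz: "x \<in> carrier ?F" "y \<in> carrier ?F" "z \<in> carrier ?F" for x y z
  proof -
    obtain a s where x: "a \<in> carrier R" "s \<in> S" "x = fraction R S a s"
      using xyz(1) by (rule fraction_carrierE)
    obtain b t where y: "b \<in> carrier R" "t \<in> S" "y = fraction R S b t"
      using xyz(2) by (rule fraction_carrierE)
    obtain c r where z: "c \<in> carrier R" "r \<in> S" "z = fraction R S c r"
      using xyz(3) by (rule fraction_carrierE)
    show "(x \<oplus>\<^bsub>?F\<^esub> y) \<oplus>\<^bsub>?F\<^esub> z = x \<oplus>\<^bsub>?F\<^esub> (y \<oplus>\<^bsub>?F\<^esub> z)"
      unfolding x(3) y(3) z(3) using x(1,2) y(1,2) z(1,2)
      by (simp add: ops, intro eqI) (simp_all add: m_ac r_distr l_distr a_ac)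
    show "(x \<oplus>\<^bsub>?F\<^esub> y) \<otimes>\<^bsub>?F\<^esub> z = x \<otimes>\<^bsub>?F\<^esub> z \<oplus>\<^bsub>?F\<^esub> y \<otimes>\<^bsub>?F\<^esub> z"
      unfolding x(3) y(3) z(3) using x(1,2) y(1,2) z(1,2)
      by (simp add: ops, intro eqI) (simp_all add: m_ac r_distr l_distr a_ac)
  qed
  show ?thesis
  proof (rule cringI)
    show "abelian_group ?F"
    proof (rule abelian_groupI)
      fix x assume "x \<in> carrier ?F"
      then obtain a s where x: "a \<in> carrier R" "s \<in> S" "x = fraction R S a s"
        by (rule fraction_carrierE)
      have "fraction R S (\<ominus> a) s \<oplus>\<^bsub>?F\<^esub> x = \<zero>\<^bsub>?F\<^esub>"
        using x by (simp add: ops l_minus l_neg) (rule eqI; simp)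
      then show "\<exists>y\<in>carrier ?F. y \<oplus>\<^bsub>?F\<^esub> x = \<zero>\<^bsub>?F\<^esub>"
        using x by (meson a_inv_closed fraction_in_carrier)
    qed (auto simp: assoc elim!: fraction_carrierE simp: ops m_comm a_comm)
    show "comm_monoid ?F"
      by (rule comm_monoidI) (auto elim!: fraction_carrierE simp: ops m_ac)
  qed (simp add: distr)
qed

end

lemma (in primeideal) localization_at_cring: "cring (localization_at R I)"
proof -
  have "submonoid (carrier R - I) R"
    using I_prime I_notcarr one_imp_carrier by unfold_locales auto
  then show ?thesis
    unfolding localization_at_def by (rule fraction_ring_cring)
qed


section \<open>Regular rings\<close>

text \<open>
  The number \<open>n\<close> is the length of the chain \<open>P 0 \<subset> \<dots> \<subset> P n\<close>. The ambient type \<^typ>\<open>enat\<close>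
  accommodates rings of infinite Krull dimension.
\<close>

definition krull_dim :: "('a, 'b) ring_scheme \<Rightarrow> enat"
  where "krull_dim R =
    Sup {enat n | n. \<exists>P. (\<forall>i\<le>n. primeideal (P i) R) \<and> (\<forall>i<n. P i \<subset> P (Suc i))}"

text \<open>The infimum is \<open>\<infinity>\<close> when \<open>I\<close> is not finitely generated.\<close>

definition min_num_gens :: "'a set \<Rightarrow> ('a, 'b) ring_scheme \<Rightarrow> enat"
  where "min_num_gens I R =
    Inf {enat (card G) | G. G \<subseteq> carrier R \<and> finite G \<and> I = Idl\<^bsub>R\<^esub> G}"

locale regular_local_ring = cring R + noetherian_ring R for R (structure) +
  assumes unique_maximal: "\<exists>!m. maximalideal m R"
    and regular: "maximalideal m R \<Longrightarrow> min_num_gens m R = krull_dim R"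

text \<open>In HOL-Algebra a \<^locale>\<open>cring\<close> may be the zero ring.\<close>

locale regular_ring = cring R + noetherian_ring R for R (structure) +
  assumes one_not_zero: "\<one> \<noteq> \<zero>"
    and localizations_regular: "primeideal P R \<Longrightarrow> regular_local_ring (localization_at R P)"


section \<open>Big ideals\<close>

text \<open>The power \<open>I\<^sup>n\<close> is taken in the monoid of ideals of \<open>R\<close> under \<^const>\<open>ideal_prod\<close>.\<close>

definition big_ideal :: "'a set \<Rightarrow> ('a, 'b) ring_scheme \<Rightarrow> bool"
  where "big_ideal J R \<longleftrightarrow> ideal J R \<and>
    (\<forall>I. ideal I R \<and> I \<subset> J \<longrightarrow>
      (\<forall>n::nat. n \<ge> 1 \<longrightarrow> I [^]\<^bsub>ideals_set R\<^esub> n \<subset> J [^]\<^bsub>ideals_set R\<^esub> n))"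

end

theory Submission
  imports Defs
begin

text \<open>
  Suppose \<open>I \<subset> M\<close> and \<open>I\<^sup>n = M\<^sup>n\<close>, and let \<open>d\<close> be the dimension of the localization at \<open>M\<close>,
  so that \<open>M\<close> is locally generated by \<open>d\<close> elements. By Nakayama \<open>I + M\<^sup>2\<close> is a proper part of \<open>M\<close>,
  hence lies in some \<open>H \<supseteq> M\<^sup>2\<close> of codimension one in \<open>M\<close>, and \<open>H\<close> is generated modulo \<open>M\<^sup>2\<close>
  by a set \<open>Y\<close> of at most \<open>d - 1\<close> elements. Then \<open>M\<^sup>n = I\<^sup>n \<subseteq> (Y) + M\<^sup>n\<^sup>+\<^sup>1\<close>, so \<open>M\<^sup>n\<close> is locally
  contained in \<open>(Y)\<close> and \<open>M\<close> is a minimal prime over \<open>Y\<close>. By Krull's height theorem the dimension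
  is at most \<open>d - 1\<close>, a contradiction. The height theorem is proved inside \<open>R\<close>
  itself: quotients are replaced by ideals containing a given one, and localization at \<open>P\<close> by
  multipliers from the complement of \<open>P\<close>.
\<close>

no_notation Sum_Type.Plus (infixr \<open><+>\<close> 65)

section \<open>Nakayama and associated primes\<close>

context cring
begin

section \<open>Elementary arithmetic of ideals and prime complements\<close>

lemma idealI_cring:
  assumes "A \<subseteq> carrier R" "\<zero> \<in> A" "\<And>x y. x \<in> A \<Longrightarrow> y \<in> A \<Longrightarrow> x \<oplus> y \<in> A"
    and mult: "\<And>r x. r \<in> carrier R \<Longrightarrow> x \<in> A \<Longrightarrow> r \<otimes> x \<in> A"
  shows "ideal A R"
proof (rule idealI)
  show "ring R" by (rule ring_axioms)
  have "\<ominus> x \<in> A" if "x \<in> A" for x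
    using mult[of "\<ominus> \<one>" x] that assms(1) by (auto simp: l_minus)
  then show "subgroup A (add_monoid R)"
    using assms by (auto simp: subgroup_def a_inv_def[symmetric])
  show "x \<otimes> a \<in> A" if "a \<in> A" "x \<in> carrier R" for a x using that mult by simp
  then show "a \<otimes> x \<in> A" if "a \<in> A" "x \<in> carrier R" for a x
    using that assms(1) m_comm by (metis subsetD)
qed

lemma ideal_props:
  assumes "ideal A R"
  shows "A \<subseteq> carrier R" "\<zero> \<in> A" "\<And>x y. x \<in> A \<Longrightarrow> y \<in> A \<Longrightarrow> x \<oplus> y \<in> A"
    "\<And>r x. r \<in> carrier R \<Longrightarrow> x \<in> A \<Longrightarrow> r \<otimes> x \<in> A"
    "\<And>r x. r \<in> carrier R \<Longrightarrow> x \<in> A \<Longrightarrow> x \<otimes> r \<in> A"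
    "\<And>x y. x \<in> A \<Longrightarrow> y \<in> A \<Longrightarrow> x \<ominus> y \<in> A" "\<And>x. x \<in> A \<Longrightarrow> x \<in> carrier R"
proof -
  interpret ideal A R by fact
  show "A \<subseteq> carrier R" "\<zero> \<in> A" "\<And>x y. x \<in> A \<Longrightarrow> y \<in> A \<Longrightarrow> x \<oplus> y \<in> A"
    "\<And>r x. r \<in> carrier R \<Longrightarrow> x \<in> A \<Longrightarrow> r \<otimes> x \<in> A"
    "\<And>r x. r \<in> carrier R \<Longrightarrow> x \<in> A \<Longrightarrow> x \<otimes> r \<in> A" "\<And>x. x \<in> A \<Longrightarrow> x \<in> carrier R"
    by (auto simp: I_l_closed I_r_closed Icarr)
  show "\<And>x y. x \<in> A \<Longrightarrow> y \<in> A \<Longrightarrow> x \<ominus> y \<in> A"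
    by (simp add: a_minus_def)
qed

lemma add_diff_cancel:
  assumes "x \<in> carrier R" "y \<in> carrier R"
  shows "(x \<oplus> y) \<ominus> x = y"
  using assms by (simp add: a_minus_def a_comm[of x y] a_assoc r_neg)

lemma mem_set_add: "x \<in> A <+> B \<longleftrightarrow> (\<exists>a\<in>A. \<exists>b\<in>B. x = a \<oplus> b)"
  by (auto simp: set_add_def')

lemma set_add_upper:
  assumes "ideal A R" "ideal B R"
  shows "A \<subseteq> A <+> B" "B \<subseteq> A <+> B"
proof -
  note a = ideal_props[OF assms(1)] and b = ideal_props[OF assms(2)]
  show "A \<subseteq> A <+> B" using a b by (auto simp: mem_set_add) (metis r_zero)
  show "B \<subseteq> A <+> B" using a b by (auto simp: mem_set_add) (metis l_zero)
qed

lemma set_add_least: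
  assumes "ideal C R" "A \<subseteq> C" "B \<subseteq> C"
  shows "A <+> B \<subseteq> C"
proof
  fix x assume "x \<in> A <+> B"
  then show "x \<in> C"
    using assms(2,3) ideal_props(3)[OF assms(1)] unfolding mem_set_add by blast
qed

text \<open>Elements outside \<open>P\<close> act as denominators. The fourth claim stands in for
  the fact that a unit minus an element of the maximal ideal of a local ring is a unit.\<close>

lemma primeideal_complement:
  assumes "primeideal P R"
  shows "\<one> \<in> carrier R - P"
    "\<And>t u. t \<in> carrier R - P \<Longrightarrow> u \<in> carrier R - P \<Longrightarrow> t \<otimes> u \<in> carrier R - P"
    "\<And>t x. t \<in> carrier R - P \<Longrightarrow> x \<in> carrier R \<Longrightarrow> t \<otimes> x \<in> P \<Longrightarrow> x \<in> P"
    "\<And>t q. t \<in> carrier R - P \<Longrightarrow> q \<in> P \<Longrightarrow> t \<ominus> q \<in> carrier R - P"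
    "ideal P R"
proof -
  interpret primeideal P R by fact
  show "\<one> \<in> carrier R - P" using one_imp_carrier I_notcarr by auto
  show "\<And>t u. t \<in> carrier R - P \<Longrightarrow> u \<in> carrier R - P \<Longrightarrow> t \<otimes> u \<in> carrier R - P"
    "\<And>t x. t \<in> carrier R - P \<Longrightarrow> x \<in> carrier R \<Longrightarrow> t \<otimes> x \<in> P \<Longrightarrow> x \<in> P"
    using I_prime by auto
  show "ideal P R" by (rule is_ideal)
  note p = ideal_props[OF this]
  show "t \<ominus> q \<in> carrier R - P" if "t \<in> carrier R - P" "q \<in> P" for t q
  proof -
    have "t = (t \<ominus> q) \<oplus> q" using that p(7) by (simp add: a_minus_def a_assoc l_neg)
    then show ?thesis using that p(3,7) by (metis Diff_iff minus_closed)
  qed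
qed

lemma genideal_insertE:
  assumes "g \<in> carrier R" "G \<subseteq> carrier R" "x \<in> Idl (insert g G)"
  obtains r w where "r \<in> carrier R" "w \<in> Idl G" "x = r \<otimes> g \<oplus> w"
proof -
  note iG = genideal_ideal[OF assms(2)] note c = cgenideal_ideal[OF assms(1)]
  have "g \<in> PIdl g" using assms(1) by (rule cgenideal_self)
  then have "insert g G \<subseteq> PIdl g <+> Idl G"
    using set_add_upper[OF c iG] genideal_self[OF assms(2)] by blast
  then have "Idl (insert g G) \<subseteq> PIdl g <+> Idl G"
    by (intro genideal_minimal add_ideals c iG)
  then have "x \<in> PIdl g <+> Idl G" using assms(3) by (rule subsetD)
  then obtain a w where "a \<in> PIdl g" "w \<in> Idl G" "x = a \<oplus> w"
    unfolding mem_set_add by blast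
  then show thesis using that unfolding cgenideal_def by blast
qed

text \<open>Since \<open>Q\<close> absorbs the coefficient with which \<open>g\<close> enters the
  second factor, the total coefficient of \<open>g\<close> stays in \<open>Q\<close>. This lets
  \<open>nakayama\<close> eliminate one generator at a time.\<close>

lemma ideal_prod_genideal_insertE:
  assumes Q: "ideal Q R" and "g \<in> carrier R" "G \<subseteq> carrier R" "x \<in> Q \<cdot> (Idl (insert g G))"
  obtains q w where "q \<in> Q" "w \<in> Q \<cdot> (Idl G)" "x = q \<otimes> g \<oplus> w"
proof -
  note q = ideal_props[OF Q] note iG = genideal_ideal[OF assms(3)]
  note p = ideal_props[OF ideal_prod_is_ideal[OF Q iG]] note g = ideal_props[OF iG]
  have "\<exists>q\<in>Q. \<exists>w\<in>Q \<cdot> (Idl G). x = q \<otimes> g \<oplus> w"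
    using assms(4)
  proof induction
    case (prod i j)
    obtain r w where rw: "r \<in> carrier R" "w \<in> Idl G" "j = r \<otimes> g \<oplus> w"
      using genideal_insertE[OF assms(2,3) prod(2)] .
    have "i \<otimes> j = (i \<otimes> r) \<otimes> g \<oplus> i \<otimes> w"
      using rw assms(2) prod q(7) g(7) by (simp add: r_distr m_assoc)
    then show ?case using rw prod q(5) ideal_prod.prod[of i Q w "Idl G" R] by blast
  next
    case (sum x y)
    then obtain q w q' w' where *: "q \<in> Q" "w \<in> Q \<cdot> (Idl G)" "x = q \<otimes> g \<oplus> w"
       "q' \<in> Q" "w' \<in> Q \<cdot> (Idl G)" "y = q' \<otimes> g \<oplus> w'" by blast
    have "q \<in> carrier R" "w \<in> carrier R" "q' \<in> carrier R" "w' \<in> carrier R"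
      using * q(7) p(7) by auto
    then have "x \<oplus> y = (q \<oplus> q') \<otimes> g \<oplus> (w \<oplus> w')"
      using * assms(2) by (simp add: l_distr a_ac)
    then show ?case using * q(3) p(3) by blast
  qed
  then show thesis using that by blast
qed

lemma ideal_prod_mono:
  assumes "A \<subseteq> A'" "B \<subseteq> B'"
  shows "A \<cdot> B \<subseteq> A' \<cdot> B'"
proof
  fix x assume "x \<in> A \<cdot> B"
  then show "x \<in> A' \<cdot> B'"
    by induction (use assms in \<open>auto intro: ideal_prod.intros\<close>)
qed

text \<open>Taking \<open>t = \<one>\<close> in the hypothesis and \<open>Q\<close> the maximal ideal of a local ring
  gives the classical form.\<close>

lemma nakayama:
  assumes Q: "primeideal Q R" and K: "ideal K R"
    and "finite G" "G \<subseteq> carrier R"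
    and "\<And>g. g \<in> G \<Longrightarrow> \<exists>t\<in>carrier R - Q. t \<otimes> g \<in> (Q \<cdot> (Idl G)) <+> K"
  shows "\<exists>t\<in>carrier R - Q. \<forall>g\<in>G. t \<otimes> g \<in> K"
  using assms(3-)
proof (induction G)
  case empty
  show ?case using primeideal_complement(1)[OF Q] by blast
next
  case (insert g G)
  note Qc = primeideal_complement[OF Q] note q = ideal_props[OF Qc(5)]
  note k = ideal_props[OF K]
  have g: "g \<in> carrier R" and G: "G \<subseteq> carrier R" using insert.prems by auto
  note iG = genideal_ideal[OF G] note iP = ideal_prod_is_ideal[OF Qc(5) iG]
  note iW = add_ideals[OF iP K] note p = ideal_props[OF iP] note w = ideal_props[OF iW]
  have decomp: "\<exists>t\<in>carrier R - Q. \<exists>q\<in>Q. \<exists>w\<in>(Q \<cdot> (Idl G)) <+> K. t \<otimes> h = q \<otimes> g \<oplus> w"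
    if h: "h \<in> insert g G" for h
  proof -
    obtain t where t: "t \<in> carrier R - Q" "t \<otimes> h \<in> (Q \<cdot> (Idl (insert g G))) <+> K"
      using insert.prems(2)[OF h] by blast
    then obtain x c where x: "x \<in> Q \<cdot> (Idl (insert g G))" "c \<in> K" "t \<otimes> h = x \<oplus> c"
      by (auto simp: mem_set_add)
    obtain r w where "r \<in> Q" "w \<in> Q \<cdot> (Idl G)" "x = r \<otimes> g \<oplus> w"
      using ideal_prod_genideal_insertE[OF Qc(5) g G x(1)] .
    then have "t \<otimes> h = r \<otimes> g \<oplus> (w \<oplus> c)" "w \<oplus> c \<in> (Q \<cdot> (Idl G)) <+> K"
      using x g q(7) p(7) k(7) by (auto simp: a_assoc mem_set_add)
    then show ?thesis using t \<open>r \<in> Q\<close> by blast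
  qed
  obtain t r v where t: "t \<in> carrier R - Q" "r \<in> Q" "v \<in> (Q \<cdot> (Idl G)) <+> K" "t \<otimes> g = r \<otimes> g \<oplus> v"
    using decomp[of g] by blast
  \<comment> \<open>Moving \<open>r \<otimes> g\<close> to the left leaves \<open>g\<close> with the
    coefficient \<open>t \<ominus> r\<close>, still outside \<open>Q\<close> because
    \<open>r\<close> lies in \<open>Q\<close>.\<close>
  define u where "u = t \<ominus> r"
  have u: "u \<in> carrier R - Q" unfolding u_def using Qc(4) t by simp
  have c: "t \<in> carrier R" "r \<in> carrier R" "v \<in> carrier R" "u \<in> carrier R"
    using t q(7) w(7) u by auto
  have "u \<otimes> g = t \<otimes> g \<ominus> r \<otimes> g" unfolding u_def using c g by (simp add: a_minus_def l_distr l_minus)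
  also have "\<dots> = v" unfolding t(4) using c g by (simp add: add_diff_cancel)
  finally have ug: "u \<otimes> g = v" .
  \<comment> \<open>Multiplying the relation for \<open>h\<close> by \<open>u\<close> replaces its
    \<open>g\<close>-term by a multiple of \<open>v\<close>, so the induction hypothesis applies to
    \<open>G\<close> alone.\<close>
  have "\<exists>t\<in>carrier R - Q. t \<otimes> h \<in> (Q \<cdot> (Idl G)) <+> K" if h: "h \<in> G" for h
  proof -
    obtain s r' v' where s: "s \<in> carrier R - Q" "r' \<in> Q" "v' \<in> (Q \<cdot> (Idl G)) <+> K" "s \<otimes> h = r' \<otimes> g \<oplus> v'"
      using decomp[of h] h by blast
    have c': "s \<in> carrier R" "r' \<in> carrier R" "v' \<in> carrier R" "h \<in> carrier R"
      using s q(7) w(7) h G by auto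
    have "(u \<otimes> s) \<otimes> h = r' \<otimes> (u \<otimes> g) \<oplus> u \<otimes> v'"
      using c c' g s(4) by (simp add: m_assoc r_distr) (simp add: m_ac)
    also have "\<dots> \<in> (Q \<cdot> (Idl G)) <+> K"
      unfolding ug using t s c c' by (intro w(3) w(4))
    finally show ?thesis using Qc(2) u s(1) by blast
  qed
  then obtain s where s: "s \<in> carrier R - Q" "\<And>h. h \<in> G \<Longrightarrow> s \<otimes> h \<in> K"
    using insert.IH G by blast
  have sw: "s \<otimes> x \<in> K" if "x \<in> Idl G" for x
  proof -
    have "ideal {x \<in> carrier R. s \<otimes> x \<in> K} R"
      using ideal.helper_max_prime[OF K is_cring] s(1) by blast
    then have "Idl G \<subseteq> {x \<in> carrier R. s \<otimes> x \<in> K}"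
      using s(2) G by (intro genideal_minimal) auto
    then show ?thesis using that by blast
  qed
  have "s \<otimes> v \<in> K"
  proof -
    obtain x c where x: "x \<in> Q \<cdot> (Idl G)" "c \<in> K" "v = x \<oplus> c"
      using t(3) by (auto simp: mem_set_add)
    have "x \<in> Idl G" using x ideal_prod_inter[OF Qc(5) iG] by blast
    then show ?thesis using x sw s(1) k p(7) by (auto simp: r_distr)
  qed
  then have "(s \<otimes> u) \<otimes> g \<in> K" using ug s(1) c g by (simp add: m_assoc)
  moreover have "(s \<otimes> u) \<otimes> h \<in> K" if "h \<in> G" for h
  proof -
    have "h \<in> carrier R" using that G by blast
    then have "(s \<otimes> u) \<otimes> h = u \<otimes> (s \<otimes> h)" using c s by (simp add: m_ac)
    then show ?thesis using s(2)[OF that] k(4) c by auto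
  qed
  ultimately show ?case using Qc(2)[OF s(1) u] by blast
qed

end

section \<open>Consequences of the Noetherian condition\<close>

locale noetherian_cring = cring R + noetherian_ring R for R (structure)
begin

text \<open>Finite generation lets one multiplier serve for all of \<open>A\<close>: the elements
  that \<open>t\<close> carries into \<open>K\<close> form an ideal containing the
  generators.\<close>

lemma nakayama_ideal:
  assumes Q: "primeideal Q R" and K: "ideal K R" and A: "ideal A R"
    and *: "\<And>a. a \<in> A \<Longrightarrow> \<exists>t\<in>carrier R - Q. t \<otimes> a \<in> (Q \<cdot> A) <+> K"
  obtains t where "t \<in> carrier R - Q" "\<And>a. a \<in> A \<Longrightarrow> t \<otimes> a \<in> K"
proof -
  obtain G where G: "G \<subseteq> carrier R" "finite G" "A = Idl G"
    using finetely_gen[OF A] by blast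
  have "G \<subseteq> A" using genideal_self G by blast
  then obtain t where t: "t \<in> carrier R - Q" "\<And>g. g \<in> G \<Longrightarrow> t \<otimes> g \<in> K"
    using nakayama[OF Q K G(2,1)] * G(3) by blast
  have "ideal {x \<in> carrier R. t \<otimes> x \<in> K} R"
    using ideal.helper_max_prime[OF K is_cring] t(1) by blast
  then have "A \<subseteq> {x \<in> carrier R. t \<otimes> x \<in> K}"
    unfolding G(3) using t(2) G by (intro genideal_minimal) auto
  then show thesis using that t(1) by blast
qed

text \<open>The ascending chain condition makes a nonempty chain of ideals contain its own union,
  which is the upper bound that Zorn's lemma asks for.\<close>

lemma ex_maximal_ideal_in:
  assumes "S \<noteq> {}" "\<And>I. I \<in> S \<Longrightarrow> ideal I R"
  shows "\<exists>I\<in>S. \<forall>J\<in>S. I \<subseteq> J \<longrightarrow> J = I"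
proof (rule subset_Zorn)
  fix C assume C: "subset.chain S C"
  show "\<exists>U\<in>S. \<forall>J\<in>C. J \<subseteq> U"
  proof (cases "C = {}")
    case True
    then show ?thesis using assms(1) by auto
  next
    case False
    have "subset.chain {I. ideal I R} C"
      using C assms(2) unfolding pred_on.chain_def by blast
    then have "\<Union>C \<in> C" using ideal_chain_is_trivial False by blast
    moreover have "C \<subseteq> S" using C unfolding pred_on.chain_def by simp
    ultimately show ?thesis by (intro bexI[of _ "\<Union>C"]) auto
  qed
qed

text \<open>An annihilator that is maximal among those of nonzero elements of \<open>R / J\<close>
  is prime: if \<open>s \<otimes> b\<close> is not in \<open>J\<close>, its annihilator contains
  that of \<open>s\<close>, hence equals it.\<close>

lemma ex_associated_prime:
  assumes J: "ideal J R" "J \<noteq> carrier R"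
  obtains s where "s \<in> carrier R - J" "primeideal {r \<in> carrier R. s \<otimes> r \<in> J} R"
proof -
  let ?A = "\<lambda>s. {r \<in> carrier R. s \<otimes> r \<in> J}"
  note j = ideal_props[OF J(1)]
  have ideal: "ideal (?A s) R" if "s \<in> carrier R" for s
    using ideal.helper_max_prime[OF J(1) is_cring that] .
  have "\<exists>B\<in>?A ` (carrier R - J). \<forall>C\<in>?A ` (carrier R - J). B \<subseteq> C \<longrightarrow> C = B"
  proof (rule ex_maximal_ideal_in)
    show "?A ` (carrier R - J) \<noteq> {}" using J(2) j(1) by blast
    show "ideal I R" if "I \<in> ?A ` (carrier R - J)" for I using that ideal by blast
  qed
  then obtain B where B: "B \<in> ?A ` (carrier R - J)"
      "\<forall>C\<in>?A ` (carrier R - J). B \<subseteq> C \<longrightarrow> C = B"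
    by (rule bexE)
  from B(1) obtain s where Bs: "B = ?A s" and s: "s \<in> carrier R - J"
    by (rule imageE)
  have max: "?A u = ?A s" if "u \<in> carrier R - J" "?A s \<subseteq> ?A u" for u
    by (rule bspec[OF B(2)[unfolded Bs] imageI[OF that(1)], THEN mp, OF that(2)])
  have "primeideal (?A s) R"
  proof (rule primeidealI)
    show "ideal (?A s) R" using ideal s by blast
    show "cring R" by (rule is_cring)
    show "carrier R \<noteq> ?A s" using s by (auto dest!: equalityD1 subsetD[of _ _ \<one>])
    fix a b assume ab: "a \<in> carrier R" "b \<in> carrier R" "a \<otimes> b \<in> ?A s"
    show "a \<in> ?A s \<or> b \<in> ?A s"
    proof (rule disjCI)
      assume b: "b \<notin> ?A s"
      then have sb: "s \<otimes> b \<in> carrier R - J" using ab s by auto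
      have "?A s \<subseteq> ?A (s \<otimes> b)"
      proof
        fix r assume r: "r \<in> ?A s"
        then have "(s \<otimes> b) \<otimes> r = b \<otimes> (s \<otimes> r)" using s ab by (simp add: m_ac)
        then show "r \<in> ?A (s \<otimes> b)" using r j(4) ab by simp
      qed
      then have "?A (s \<otimes> b) = ?A s" using max[OF sb] by blast
      moreover have "(s \<otimes> b) \<otimes> a \<in> J" using ab s by (simp add: m_ac)
      ultimately show "a \<in> ?A s" using ab by blast
    qed
  qed
  then show thesis using that s by blast
qed

end

section \<open>Minimal primes and saturated ideals\<close>

context cring
begin

text \<open>\<open>I\<close> may be any subset, so that a finite set of generators can be used
  directly.\<close>

definition minimal_prime_over :: "'a set \<Rightarrow> 'a set \<Rightarrow> bool"
  where "minimal_prime_over P I \<longleftrightarrow> primeideal P R \<and> I \<subseteq> P \<and>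
    (\<forall>P'. primeideal P' R \<longrightarrow> I \<subseteq> P' \<longrightarrow> P' \<subseteq> P \<longrightarrow> P' = P)"

text \<open>For prime \<open>P\<close> these are the contractions to \<open>R\<close> of the ideals
  of the localization at \<open>P\<close>.\<close>

definition saturated :: "'a set \<Rightarrow> 'a set \<Rightarrow> bool"
  where "saturated P A \<longleftrightarrow> ideal A R \<and> (\<forall>t\<in>carrier R - P. \<forall>x\<in>carrier R. t \<otimes> x \<in> A \<longrightarrow> x \<in> A)"

text \<open>The contraction to \<open>R\<close> of the extension of \<open>A\<close> to the localization at \<open>P\<close>.\<close>

definition saturation :: "'a set \<Rightarrow> 'a set \<Rightarrow> 'a set"
  where "saturation P A = {x \<in> carrier R. \<exists>t\<in>carrier R - P. t \<otimes> x \<in> A}"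

lemma saturatedD:
  "saturated P A \<Longrightarrow> t \<in> carrier R - P \<Longrightarrow> x \<in> carrier R \<Longrightarrow> t \<otimes> x \<in> A \<Longrightarrow> x \<in> A"
  unfolding saturated_def by blast

lemma saturated_ideal: "saturated P A \<Longrightarrow> ideal A R"
  unfolding saturated_def by blast

lemma saturation_saturated:
  assumes P: "primeideal P R" and A: "ideal A R"
  shows "saturated P (saturation P A)"
  unfolding saturated_def
proof (intro conjI ballI impI)
  note p = primeideal_complement[OF P] note a = ideal_props[OF A]
  show "ideal (saturation P A) R"
  proof (rule idealI_cring)
    show "\<zero> \<in> saturation P A" using p(1) a(2) by (auto simp: saturation_def)
    show "x \<oplus> y \<in> saturation P A" if xy: "x \<in> saturation P A" "y \<in> saturation P A" for x y
    proof -
      obtain t where t: "t \<in> carrier R - P" "t \<otimes> x \<in> A" "x \<in> carrier R"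
        using xy(1) unfolding saturation_def by blast
      obtain u where u: "u \<in> carrier R - P" "u \<otimes> y \<in> A" "y \<in> carrier R"
        using xy(2) unfolding saturation_def by blast
      have "(t \<otimes> u) \<otimes> (x \<oplus> y) = u \<otimes> (t \<otimes> x) \<oplus> t \<otimes> (u \<otimes> y)"
        using t u by (simp add: r_distr) (simp add: m_ac)
      also have "\<dots> \<in> A" using t u a by auto
      finally show ?thesis using p(2) t u unfolding saturation_def by blast
    qed
    show "r \<otimes> x \<in> saturation P A" if rx: "r \<in> carrier R" "x \<in> saturation P A" for r x
    proof -
      obtain t where t: "t \<in> carrier R - P" "t \<otimes> x \<in> A" "x \<in> carrier R"
        using rx(2) unfolding saturation_def by blast
      have "t \<otimes> (r \<otimes> x) = r \<otimes> (t \<otimes> x)" using t rx by (simp add: m_ac)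
      also have "\<dots> \<in> A" using t rx a(4) by blast
      finally show ?thesis using t rx unfolding saturation_def by blast
    qed
  qed (auto simp: saturation_def)
  show "x \<in> saturation P A" if t: "t \<in> carrier R - P" and x: "x \<in> carrier R" "t \<otimes> x \<in> saturation P A" for t x
  proof -
    obtain u where u: "u \<in> carrier R - P" "u \<otimes> (t \<otimes> x) \<in> A"
      using x(2) unfolding saturation_def by blast
    then have "(u \<otimes> t) \<otimes> x \<in> A" using t x(1) by (simp add: m_assoc)
    then show ?thesis using p(2)[OF u(1) t] x(1) unfolding saturation_def by blast
  qed
qed

lemma saturation_upper:
  assumes P: "primeideal P R" and A: "A \<subseteq> carrier R"
  shows "A \<subseteq> saturation P A"
  using primeideal_complement(1)[OF P] A unfolding saturation_def by force

lemma saturation_least: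
  assumes "saturated P B" "A \<subseteq> B"
  shows "saturation P A \<subseteq> B"
  using assms unfolding saturated_def saturation_def by blast

lemma saturation_mono: "A \<subseteq> B \<Longrightarrow> saturation P A \<subseteq> saturation P B"
  unfolding saturation_def by blast

end

context noetherian_cring
begin

text \<open>The associated prime of \<open>J\<close> contains \<open>I\<close>, and saturation of
  \<open>J\<close> forces it into \<open>P\<close>; by minimality it is \<open>P\<close>. Modulo
  \<open>J\<close> and after localization, \<open>s\<close> thus spans a copy of the residue
  field.\<close>

lemma ex_socle_element:
  assumes P: "minimal_prime_over P I" and J: "saturated P J" "I \<subseteq> J" "J \<noteq> carrier R"
  obtains s where "s \<in> carrier R - J" "\<And>r. r \<in> P \<Longrightarrow> s \<otimes> r \<in> J"
proof -
  note j = ideal_props[OF saturated_ideal[OF J(1)]]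
  obtain s where s: "s \<in> carrier R - J" "primeideal {r \<in> carrier R. s \<otimes> r \<in> J} R"
    using ex_associated_prime[OF saturated_ideal[OF J(1)] J(3)] .
  have "I \<subseteq> {r \<in> carrier R. s \<otimes> r \<in> J}"
    using J(2) s(1) j(4,7) by auto
  moreover have "{r \<in> carrier R. s \<otimes> r \<in> J} \<subseteq> P"
  proof
    fix r assume r: "r \<in> {r \<in> carrier R. s \<otimes> r \<in> J}"
    then have "r \<otimes> s \<in> J" using s(1) m_comm[of r s] by simp
    then show "r \<in> P" using saturatedD[OF J(1), of r s] s(1) r by blast
  qed
  ultimately have "{r \<in> carrier R. s \<otimes> r \<in> J} = P"
    using P s(2) unfolding minimal_prime_over_def by blast
  then show thesis using that s(1) by blast
qed

text \<open>In the localization at \<open>P\<close> modulo \<open>I\<close>, the image of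
  \<open>P\<close> is the only prime and so consists of nilpotents. The proof shows that the ideal
  \<open>K\<close> of elements killed by a power of \<open>x\<close>, up to a multiplier, contains
  \<open>\<one>\<close>.\<close>

lemma minimal_prime_over_nilpotent:
  assumes P: "minimal_prime_over P I" and I: "ideal I R" and x: "x \<in> P"
  obtains t n where "t \<in> carrier R - P" "t \<otimes> x [^] (n::nat) \<in> I"
proof -
  have prime: "primeideal P R" and IP: "I \<subseteq> P" using P by (auto simp: minimal_prime_over_def)
  note p = primeideal_complement[OF prime] note i = ideal_props[OF I]
  have xc: "x \<in> carrier R" using x ideal_props(7)[OF p(5)] by blast
  define K where "K = {y \<in> carrier R. \<exists>t\<in>carrier R - P. \<exists>n::nat. (t \<otimes> x [^] n) \<otimes> y \<in> I}"
  have "ideal K R"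
  proof (rule idealI_cring)
    have "(\<one> \<otimes> x [^] (0::nat)) \<otimes> \<zero> \<in> I" using i(2) by simp
    then show "\<zero> \<in> K" using p(1) unfolding K_def by blast
    show "y \<oplus> z \<in> K" if yz: "y \<in> K" "z \<in> K" for y z
    proof -
      obtain t n where t: "t \<in> carrier R - P" "(t \<otimes> x [^] (n::nat)) \<otimes> y \<in> I" "y \<in> carrier R"
        using yz(1) unfolding K_def by blast
      obtain u m where u: "u \<in> carrier R - P" "(u \<otimes> x [^] (m::nat)) \<otimes> z \<in> I" "z \<in> carrier R"
        using yz(2) unfolding K_def by blast
      have "((t \<otimes> u) \<otimes> x [^] (n + m)) \<otimes> (y \<oplus> z)
          = (u \<otimes> x [^] m) \<otimes> ((t \<otimes> x [^] n) \<otimes> y) \<oplus> (t \<otimes> x [^] n) \<otimes> ((u \<otimes> x [^] m) \<otimes> z)"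
        using t u xc by (simp add: r_distr nat_pow_mult[symmetric]) (simp add: m_ac)
      also have "\<dots> \<in> I" using t u i(3,4) xc by auto
      finally show ?thesis using p(2)[OF t(1) u(1)] t(3) u(3) unfolding K_def by blast
    qed
    show "r \<otimes> y \<in> K" if ry: "r \<in> carrier R" "y \<in> K" for r y
    proof -
      obtain t n where t: "t \<in> carrier R - P" "(t \<otimes> x [^] (n::nat)) \<otimes> y \<in> I" "y \<in> carrier R"
        using ry(2) unfolding K_def by blast
      have "(t \<otimes> x [^] n) \<otimes> (r \<otimes> y) = r \<otimes> ((t \<otimes> x [^] n) \<otimes> y)"
        using t xc ry(1) by (simp add: m_ac)
      also have "\<dots> \<in> I" using t(2) ry(1) i(4) by blast
      finally show ?thesis using t ry(1) unfolding K_def by blast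
    qed
  qed (auto simp: K_def)
  moreover have "y \<in> K" if t: "t \<in> carrier R - P" and y: "y \<in> carrier R" "t \<otimes> y \<in> K" for t y
  proof -
    obtain u n where u: "u \<in> carrier R - P" "(u \<otimes> x [^] (n::nat)) \<otimes> (t \<otimes> y) \<in> I"
      using y(2) unfolding K_def by blast
    have "(u \<otimes> x [^] n) \<otimes> (t \<otimes> y) = ((u \<otimes> t) \<otimes> x [^] n) \<otimes> y"
      using u(1) t y(1) xc by (simp add: m_ac)
    then show ?thesis using u p(2)[OF u(1) t] y(1) unfolding K_def by auto
  qed
  ultimately have sat: "saturated P K" unfolding saturated_def by blast
  have "y \<in> K" if y: "y \<in> I" for y
  proof -
    have "(\<one> \<otimes> x [^] (0::nat)) \<otimes> y \<in> I" using y i(7) by simp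
    then show ?thesis using p(1) y i(7) unfolding K_def by blast
  qed
  then have IK: "I \<subseteq> K" by blast
  \<comment> \<open>If \<open>K\<close> were proper, \<open>x\<close> would carry a socle element
    \<open>s\<close> into \<open>K\<close>; one more power of \<open>x\<close> then puts
    \<open>s\<close> itself into \<open>K\<close>.\<close>
  have "K = carrier R"
  proof (rule ccontr)
    assume "K \<noteq> carrier R"
    then obtain s where s: "s \<in> carrier R - K" "\<And>r. r \<in> P \<Longrightarrow> s \<otimes> r \<in> K"
      using ex_socle_element[OF P sat IK] by blast
    then obtain t n where t: "t \<in> carrier R - P" "(t \<otimes> x [^] (n::nat)) \<otimes> (s \<otimes> x) \<in> I"
      using s(2)[OF x] unfolding K_def by blast
    have "(t \<otimes> x [^] n) \<otimes> (s \<otimes> x) = (t \<otimes> x [^] Suc n) \<otimes> s"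
      using t(1) s(1) xc by (simp add: m_ac)
    then have "(t \<otimes> x [^] Suc n) \<otimes> s \<in> I" using t(2) by simp
    then have "s \<in> K" using t(1) s(1) unfolding K_def by blast
    then show False using s(1) by blast
  qed
  then obtain t n where "t \<in> carrier R - P" "(t \<otimes> x [^] (n::nat)) \<otimes> \<one> \<in> I"
    using one_closed unfolding K_def by blast
  then show thesis using that xc by simp
qed

text \<open>In the localization at \<open>P\<close>, the quotient by \<open>I\<close> is Artinian.\<close>

lemma saturated_chain_stabilizes:
  assumes P: "minimal_prime_over P I"
    and A: "\<And>k. saturated P (A k)" "\<And>k. I \<subseteq> A k" "decseq A"
  shows "\<exists>k0. \<forall>k\<ge>k0. A k = A k0"
proof (rule ccontr)
  have prime: "primeideal P R" using P by (simp add: minimal_prime_over_def)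
  note p = primeideal_complement[OF prime]
  assume unstable: "\<not> (\<exists>k0. \<forall>k\<ge>k0. A k = A k0)"
  \<comment> \<open>Noetherian induction: a bad \<open>J\<close> has an unstable descending chain of
    saturated ideals above it, and a maximal bad \<open>J\<close> will be refuted.\<close>
  define bad where "bad J \<longleftrightarrow> saturated P J \<and> I \<subseteq> J \<and>
    (\<exists>A. (\<forall>k. saturated P (A k)) \<and> (\<forall>k. J \<subseteq> A k) \<and> decseq A \<and> \<not> (\<exists>k0. \<forall>k\<ge>k0. A k = A k0))"
    for J :: "'a set"
  have IA: "I \<subseteq> carrier R" using A(2) ideal_props(1)[OF saturated_ideal[OF A(1)]] by blast
  \<comment> \<open>\<open>I\<close> is only a set here, so the initial bad ideal is the saturation
    of the ideal it generates.\<close>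
  have "I \<subseteq> Idl I" using genideal_self[OF IA] .
  moreover have "Idl I \<subseteq> saturation P (Idl I)"
    using saturation_upper[OF prime] ideal_props(1)[OF genideal_ideal[OF IA]] by blast
  ultimately have "I \<subseteq> saturation P (Idl I)" by blast
  moreover have "saturation P (Idl I) \<subseteq> A k" for k
    using saturation_least[OF A(1)] genideal_minimal[OF saturated_ideal[OF A(1)] A(2)] by blast
  ultimately have "bad (saturation P (Idl I))"
    unfolding bad_def using A unstable saturation_saturated[OF prime genideal_ideal[OF IA]] by blast
  then have "{J. bad J} \<noteq> {}" by blast
  moreover have "ideal J R" if "J \<in> {J. bad J}" for J
    using that unfolding bad_def saturated_def by blast
  ultimately obtain J where "bad J" and max: "\<And>J'. bad J' \<Longrightarrow> J \<subseteq> J' \<Longrightarrow> J' = J"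
    using ex_maximal_ideal_in[of "{J. bad J}"] by blast
  then obtain B where J: "saturated P J" "I \<subseteq> J" and B: "\<And>k. saturated P (B k)" "\<And>k. J \<subseteq> B k" "decseq B"
      and unstable_B: "\<not> (\<exists>k0. \<forall>k\<ge>k0. B k = B k0)"
    unfolding bad_def by blast
  note iJ = saturated_ideal[OF J(1)] note iB = saturated_ideal[OF B(1)]
  note j = ideal_props[OF iJ] note b = ideal_props[OF iB]
  have "J \<noteq> carrier R"
  proof
    assume "J = carrier R"
    then have "B k = carrier R" for k using B(2)[of k] b(1)[of k] by blast
    then show False using unstable_B by simp
  qed
  then obtain s where s: "s \<in> carrier R - J" "\<And>r. r \<in> P \<Longrightarrow> s \<otimes> r \<in> J"
    using ex_socle_element[OF P J] by blast
  have sc: "s \<in> carrier R" using s by blast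
  \<comment> \<open>Adjoining \<open>s\<close> enlarges \<open>J\<close> strictly, so by maximality
    of \<open>J\<close> the chain of saturated sums \<open>C k\<close> must stabilize.\<close>
  define L where "L = J <+> PIdl s"
  have iL: "ideal L R" unfolding L_def by (intro add_ideals iJ cgenideal_ideal sc)
  have sL: "s \<in> L" and JL: "J \<subseteq> L"
    using set_add_upper[OF iJ cgenideal_ideal[OF sc]] cgenideal_self[OF sc] unfolding L_def by auto
  define C where "C k = saturation P (B k <+> L)" for k
  have iBL: "ideal (B k <+> L) R" for k by (intro add_ideals iB iL)
  have C: "saturated P (C k)" "L \<subseteq> C k" "B k <+> L \<subseteq> C k" for k
  proof -
    show "saturated P (C k)" unfolding C_def using saturation_saturated[OF prime iBL] .
    show "B k <+> L \<subseteq> C k"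
      unfolding C_def using saturation_upper[OF prime] ideal_props(1)[OF iBL] by blast
    then show "L \<subseteq> C k" using set_add_upper(2)[OF iB iL] by blast
  qed
  have dec: "decseq C"
  proof (rule decseq_SucI)
    have "B (Suc k) <+> L \<subseteq> B k <+> L" for k
      using decseq_SucD[OF B(3), of k] unfolding set_add_def' by blast
    then show "C (Suc k) \<subseteq> C k" for k unfolding C_def by (intro saturation_mono)
  qed
  have "\<exists>k0. \<forall>k\<ge>k0. C k = C k0"
  proof (rule ccontr)
    assume unstable_C: "\<not> (\<exists>k0. \<forall>k\<ge>k0. C k = C k0)"
    have "L \<subseteq> saturation P L" using saturation_upper[OF prime] ideal_props(1)[OF iL] by blast
    moreover have "saturation P L \<subseteq> C k" for k using saturation_least[OF C(1)] C(2) by blast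
    ultimately have "bad (saturation P L)"
      unfolding bad_def using saturation_saturated[OF prime iL] J(2) JL C(1) dec unstable_C by blast
    then have "saturation P L = J" using max \<open>L \<subseteq> saturation P L\<close> JL by blast
    then show False using \<open>L \<subseteq> saturation P L\<close> sL s(1) by blast
  qed
  then obtain k1 where k1: "\<And>k. k \<ge> k1 \<Longrightarrow> C k = C k1" by blast
  text \<open>\<open>L / J\<close> is simple up to saturation.\<close>
  have simple: "s \<in> B k" if x: "x \<in> B k" "x \<in> L" "x \<notin> J" for x k
  proof -
    obtain y r where y: "y \<in> J" "r \<in> carrier R" "x = y \<oplus> r \<otimes> s"
      using x(2) unfolding L_def mem_set_add cgenideal_def by blast
    have "r \<notin> P"
    proof
      assume "r \<in> P"
      then have "r \<otimes> s \<in> J" using s(2)[of r] sc y(2) m_comm[of r s] by simp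
      then show False using x(3) y j(3) by blast
    qed
    have "r \<otimes> s = x \<ominus> y"
      unfolding y(3) using y(2) sc j(7)[OF y(1)] by (simp add: add_diff_cancel)
    also have "\<dots> \<in> B k" using b(6)[OF x(1)] B(2) y(1) by blast
    finally show "s \<in> B k" using saturatedD[OF B(1)] y(2) \<open>r \<notin> P\<close> sc by blast
  qed
  \<comment> \<open>Either \<open>s\<close>, and with it \<open>L\<close>, stays in every
    \<open>B k\<close>, or by simplicity some intersection with \<open>L\<close> shrinks into
    \<open>J\<close>.\<close>
  have "\<exists>k2. \<forall>k\<ge>k2. B k2 \<inter> L \<subseteq> B k"
  proof (cases "\<forall>k. s \<in> B k")
    case True
    then have "PIdl s \<subseteq> B k" for k by (intro cgenideal_minimal iB) simp
    then have "L \<subseteq> B k" for k unfolding L_def by (intro set_add_least iB B(2))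
    then show ?thesis by blast
  next
    case False
    then obtain k2 where "s \<notin> B k2" by blast
    then have "B k2 \<inter> L \<subseteq> J" using simple by blast
    then show ?thesis using B(2) by blast
  qed
  then obtain k2 where k2: "\<And>k. k \<ge> k2 \<Longrightarrow> B k2 \<inter> L \<subseteq> B k" by blast
  \<comment> \<open>Modular law up to a multiplier: the two nested ideals have the same saturated
    sum with \<open>L\<close>, and the larger one meets \<open>L\<close> inside the smaller.\<close>
  have "B k = B (max k1 k2)" if k: "k \<ge> max k1 k2" for k
  proof
    let ?m = "max k1 k2"
    show "B k \<subseteq> B ?m" using decseqD[OF B(3) k] .
    show "B ?m \<subseteq> B k"
    proof
      fix x assume x: "x \<in> B ?m"
      have "x \<in> C ?m" using x C(3) set_add_upper(1)[OF iB iL] by blast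
      then have "x \<in> C k" using k1[of k] k1[of ?m] k by simp
      then obtain t where t: "t \<in> carrier R - P" "t \<otimes> x \<in> B k <+> L" and xc: "x \<in> carrier R"
        unfolding C_def saturation_def by blast
      then obtain y z where yz: "y \<in> B k" "z \<in> L" "t \<otimes> x = y \<oplus> z"
        unfolding mem_set_add by blast
      have y': "y \<in> B ?m" using yz(1) decseqD[OF B(3) k] by blast
      have "z = t \<otimes> x \<ominus> y"
        unfolding yz(3) using ideal_props(7)[OF iL yz(2)] b(7)[OF yz(1)] by (simp add: add_diff_cancel)
      also have "\<dots> \<in> B ?m" using b(6)[OF b(4)[OF _ x] y'] t(1) by blast
      finally have "z \<in> B k2 \<inter> L" using yz(2) decseqD[OF B(3), of k2 ?m] by auto
      then have "z \<in> B k" using k2[of k] k by auto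
      then have "t \<otimes> x \<in> B k" using b(3) yz by simp
      then show "x \<in> B k" using saturatedD[OF B(1) t(1) xc] by blast
    qed
  qed
  then show False using unstable_B by blast
qed

end

section \<open>The height theorem\<close>

context cring
begin

section \<open>Powers of ideals and their relation to primes\<close>

abbreviation ideal_pow :: "'a set \<Rightarrow> nat \<Rightarrow> 'a set"
  where "ideal_pow A n \<equiv> A [^]\<^bsub>ideals_set R\<^esub> n"

lemma ideals_set_one: "\<one>\<^bsub>ideals_set R\<^esub> = carrier R"
  and ideals_set_mult: "A \<otimes>\<^bsub>ideals_set R\<^esub> B = A \<cdot> B"
  by (simp_all add: ideals_set_def)

lemma ideal_pow_Suc: "ideal_pow A (Suc n) = ideal_pow A n \<cdot> A"
  by (simp add: ideals_set_mult)

lemma ideal_pow_ideal: "ideal A R \<Longrightarrow> ideal (ideal_pow A n) R"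
  by (induction n) (auto simp: ideals_set_one ideals_set_mult intro: oneideal ideal_prod_is_ideal)

lemma ideal_pow_Suc_subset: "ideal A R \<Longrightarrow> ideal_pow A (Suc n) \<subseteq> ideal_pow A n"
  unfolding ideal_pow_Suc using ideal_prod_inter[OF ideal_pow_ideal] by blast

lemma ideal_pow_mono:
  assumes "A \<subseteq> B"
  shows "ideal_pow A n \<subseteq> ideal_pow B n"
proof (induction n)
  case (Suc n)
  then show ?case unfolding ideal_pow_Suc using assms by (rule ideal_prod_mono)
qed simp

lemma nat_pow_mem_ideal_pow:
  assumes "ideal A R" "x \<in> A"
  shows "x [^] n \<in> ideal_pow A n"
  using assms by (induction n) (auto simp: ideals_set_one ideals_set_mult intro: ideal_prod.prod)

lemma primeideal_nat_powD:
  assumes P: "primeideal P R" and x: "x \<in> carrier R" "x [^] (n::nat) \<in> P"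
  shows "x \<in> P"
  using x(2)
proof (induction n)
  case 0
  then show ?case using primeideal_complement(1)[OF P] by simp
next
  case (Suc n)
  then show ?case using primeideal.I_prime[OF P, of "x [^] n" x] x(1) by auto
qed

lemma primeideal_ideal_powD:
  assumes "primeideal P R" "ideal A R" "ideal_pow A n \<subseteq> P"
  shows "A \<subseteq> P"
  using assms nat_pow_mem_ideal_pow[OF assms(2)] ideal_props(7)[OF assms(2)]
    primeideal_nat_powD[OF assms(1)] by blast

lemma minimal_prime_over_genideal:
  assumes "minimal_prime_over P G"
  shows "minimal_prime_over P (Idl G)"
proof -
  have P: "primeideal P R" "G \<subseteq> P" using assms by (auto simp: minimal_prime_over_def)
  note iP = primeideal_complement(5)[OF P(1)]
  have G: "G \<subseteq> Idl G" using genideal_self P(2) ideal_props(1)[OF iP] by blast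
  show ?thesis
    unfolding minimal_prime_over_def
  proof (intro conjI allI impI)
    show "Idl G \<subseteq> P" using genideal_minimal[OF iP P(2)] .
    fix P' assume "primeideal P' R" "Idl G \<subseteq> P'" "P' \<subseteq> P"
    then show "P' = P" using assms G unfolding minimal_prime_over_def by blast
  qed (rule P(1))
qed

end

context noetherian_cring
begin

text \<open>Krull's principal ideal theorem in \<open>R / Q1\<close>: the sets \<open>S k\<close> below are the
  symbolic powers of the image of \<open>Q\<close> in \<open>R / Q1\<close>, pulled back to \<open>R\<close>.\<close>

lemma krull_principal_ideal:
  assumes P: "minimal_prime_over P (insert a Y)"
    and Q: "primeideal Q R" "Q \<subset> P" and Q1: "primeideal Q1 R" "Q1 \<subseteq> Q" "Y \<subseteq> Q1"
  shows "Q1 = Q"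
proof -
  have prime: "primeideal P R" and YP: "insert a Y \<subseteq> P"
    using P by (auto simp: minimal_prime_over_def)
  note p = primeideal_complement[OF prime] note q = primeideal_complement[OF Q(1)]
  note q1 = primeideal_complement[OF Q1(1)]
  have ac: "a \<in> carrier R" "a \<in> P" using YP ideal_props(7)[OF p(5)] by auto
  note ia = cgenideal_ideal[OF ac(1)]
  have aQ: "a \<notin> Q"
  proof
    assume "a \<in> Q"
    then have "insert a Y \<subseteq> Q" using Q1 by blast
    then show False using P Q unfolding minimal_prime_over_def by blast
  qed
  note ipow = ideal_pow_ideal[OF q(5)]
  note iQ = add_ideals[OF ipow q1(5)]
  define S where "S k = saturation Q (ideal_pow Q k <+> Q1)" for k
  have S: "saturated Q (S k)" for k
    unfolding S_def using saturation_saturated[OF Q(1) iQ] .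
  note iS = saturated_ideal[OF S]
  have sub_S: "ideal_pow Q k <+> Q1 \<subseteq> S k" for k
    unfolding S_def using saturation_upper[OF Q(1)] ideal_props(1)[OF iQ] by blast
  have S_dec: "S (Suc k) \<subseteq> S k" for k
    unfolding S_def using ideal_pow_Suc_subset[OF q(5), of k]
    by (intro saturation_mono) (auto simp: set_add_def')
  note iSa = add_ideals[OF iS ia]
  \<comment> \<open>These saturated ideals contain \<open>insert a Y\<close>, over which
    \<open>P\<close> is minimal, so their descending chain stabilizes.\<close>
  define B where "B k = saturation P (S k <+> PIdl a)" for k
  have B: "saturated P (B k)" for k
    unfolding B_def using saturation_saturated[OF prime iSa] .
  have sub_B: "S k <+> PIdl a \<subseteq> B k" for k
    unfolding B_def using saturation_upper[OF prime] ideal_props(1)[OF iSa] by blast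
  have "insert a Y \<subseteq> B k" for k
  proof -
    have "Y \<subseteq> S k" using Q1(3) set_add_upper(2)[OF ipow q1(5)] sub_S by blast
    then show ?thesis using set_add_upper[OF iS ia] cgenideal_self[OF ac(1)] sub_B by blast
  qed
  moreover have "decseq B"
  proof (rule decseq_SucI)
    have "S (Suc k) <+> PIdl a \<subseteq> S k <+> PIdl a" for k
      using S_dec[of k] unfolding set_add_def' by blast
    then show "B (Suc k) \<subseteq> B k" for k unfolding B_def by (intro saturation_mono)
  qed
  ultimately have "\<exists>k. \<forall>j\<ge>k. B j = B k"
    by (rule saturated_chain_stabilizes[OF P B])
  then obtain k where k: "\<forall>j\<ge>k. B j = B k" by (rule exE)
  have Bk: "B k = B (Suc k)" by (rule k[rule_format, of "Suc k", symmetric]) simp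
  \<comment> \<open>Stability gives \<open>t \<otimes> x = y \<oplus> r \<otimes> a\<close> with
    \<open>y\<close> in \<open>S (Suc k)\<close>. As \<open>a\<close> is outside \<open>Q\<close>
    and \<open>S k\<close> is saturated at \<open>Q\<close>, the coefficient \<open>r\<close> lies
    in \<open>S k\<close>, while \<open>a\<close> supplies the factor from \<open>P\<close>.\<close>
  have "\<exists>t\<in>carrier R - P. t \<otimes> x \<in> (P \<cdot> S k) <+> S (Suc k)" if x: "x \<in> S k" for x
  proof -
    have "x \<in> B (Suc k)" using x set_add_upper(1)[OF iS ia] sub_B Bk by blast
    then obtain t where t: "t \<in> carrier R - P" "t \<otimes> x \<in> S (Suc k) <+> PIdl a"
      unfolding B_def saturation_def by blast
    then obtain y r where y: "y \<in> S (Suc k)" "r \<in> carrier R" "t \<otimes> x = y \<oplus> r \<otimes> a"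
      unfolding mem_set_add cgenideal_def by blast
    note s = ideal_props[OF iS]
    have yk: "y \<in> S k" using y(1) S_dec by blast
    have "a \<otimes> r = t \<otimes> x \<ominus> y"
      unfolding y(3) using y(2) ac(1) s(7)[OF y(1)] by (simp add: add_diff_cancel m_comm)
    also have "\<dots> \<in> S k" using s(6)[OF s(4)[OF _ x] yk] t(1) by blast
    finally have "r \<in> S k" using saturatedD[OF S] ac(1) aQ y(2) by blast
    then have "a \<otimes> r \<in> P \<cdot> S k" using ac(2) by (rule ideal_prod.prod[rotated])
    moreover have "t \<otimes> x = a \<otimes> r \<oplus> y"
      using y ac(1) s(7)[OF y(1)] by (simp add: m_comm a_comm)
    ultimately show ?thesis using t(1) y(1) unfolding mem_set_add by blast
  qed
  then obtain t where t: "t \<in> carrier R - P" "\<And>x. x \<in> S k \<Longrightarrow> t \<otimes> x \<in> S (Suc k)"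
    using nakayama_ideal[OF prime iS iS] by blast
  have S_eq: "S k \<subseteq> S (Suc k)"
  proof
    fix x assume x: "x \<in> S k"
    have "t \<in> carrier R - Q" using t(1) Q(2) by blast
    then show "x \<in> S (Suc k)"
      using saturatedD[OF S] t(2)[OF x] ideal_props(7)[OF iS x] by blast
  qed
  \<comment> \<open>Nakayama a second time, now at \<open>Q\<close>: two equal consecutive symbolic
    powers make \<open>ideal_pow Q k\<close> vanish modulo \<open>Q1\<close> up to a multiplier, and
    \<open>Q1\<close> is prime.\<close>
  have "\<exists>t\<in>carrier R - Q. t \<otimes> x \<in> (Q \<cdot> ideal_pow Q k) <+> Q1" if "x \<in> ideal_pow Q k" for x
  proof -
    have "x \<in> S (Suc k)" using that set_add_upper(1)[OF ipow q1(5)] sub_S S_eq by blast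
    then show ?thesis
      unfolding S_def saturation_def ideal_pow_Suc ideal_prod_commute[OF ipow q(5)] by blast
  qed
  then obtain t where t: "t \<in> carrier R - Q" "\<And>x. x \<in> ideal_pow Q k \<Longrightarrow> t \<otimes> x \<in> Q1"
    using nakayama_ideal[OF Q(1) q1(5) ipow] by blast
  have "ideal_pow Q k \<subseteq> Q1"
  proof
    fix x assume x: "x \<in> ideal_pow Q k"
    have "t \<in> carrier R - Q1" using t(1) Q1(2) by blast
    then show "x \<in> Q1" using q1(3) t(2)[OF x] ideal_props(7)[OF ipow x] by blast
  qed
  then show "Q1 = Q" using primeideal_ideal_powD[OF Q1(1) q(5)] Q1(2) by blast
qed

text \<open>Induction on the number of generators: a suitable prime \<open>Q\<close> just below
  \<open>P\<close> is minimal over a set with one generator fewer. The bound on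
  \<open>card G\<close> is an inequality because modified generators may coincide.\<close>

lemma krull_height:
  assumes "finite G" "card G \<le> n" "minimal_prime_over P G"
    and "\<And>i. i \<le> l \<Longrightarrow> primeideal (C i) R" "\<And>i. i < l \<Longrightarrow> C i \<subset> C (Suc i)" "C l \<subseteq> P"
  shows "l \<le> n"
  using assms
proof (induction n arbitrary: G P l)
  case 0
  show ?case
  proof (rule ccontr)
    assume "\<not> l \<le> 0"
    then obtain m where l: "l = Suc m" by (cases l) auto
    have "primeideal (C m) R" "C m \<subset> P" "G \<subseteq> C m"
      using 0(4)[of m] 0(5)[of m] 0(1,2,6) l by auto
    then show False using 0(3) unfolding minimal_prime_over_def by blast
  qed
next
  case (Suc n)
  show ?case
  proof (cases l)
    case (Suc m)
    have prime: "primeideal P R" and GP: "G \<subseteq> P"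
      using Suc.prems(3) by (auto simp: minimal_prime_over_def)
    note p = primeideal_complement[OF prime]
    \<comment> \<open>A maximal member \<open>Q\<close> has no prime strictly between itself and
      \<open>P\<close>, and the chain up to \<open>C m\<close> ends inside it.\<close>
    let ?S = "{Q. primeideal Q R \<and> C m \<subseteq> Q \<and> Q \<subset> P}"
    have "C m \<subset> P" using Suc.prems(5)[of m] Suc.prems(6) Suc by blast
    then have "C m \<in> ?S" using Suc.prems(4)[of m] Suc by simp
    moreover have "ideal Q R" if "Q \<in> ?S" for Q
      using that primeideal_complement(5) by blast
    ultimately have "\<exists>Q\<in>?S. \<forall>J\<in>?S. Q \<subseteq> J \<longrightarrow> J = Q"
      by (intro ex_maximal_ideal_in) blast+
    then obtain Q where Q': "Q \<in> ?S" and max': "\<forall>J\<in>?S. Q \<subseteq> J \<longrightarrow> J = Q" by (rule bexE)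
    then have Q: "primeideal Q R" "C m \<subseteq> Q" "Q \<subset> P" by auto
    have max: "J = Q" if "primeideal J R" "Q \<subseteq> J" "J \<subset> P" for J
      using max' that Q(2) by auto
    note q = primeideal_complement[OF Q(1)]
    obtain a where a: "a \<in> G" "a \<notin> Q"
      using Suc.prems(3) Q unfolding minimal_prime_over_def by blast
    have ac: "a \<in> carrier R" using a(1) GP ideal_props(7)[OF p(5)] by blast
    have "minimal_prime_over P (insert a Q)"
      unfolding minimal_prime_over_def
    proof (intro conjI allI impI)
      show "insert a Q \<subseteq> P" using a(1) GP Q(3) by blast
      show "P' = P" if "primeideal P' R" "insert a Q \<subseteq> P'" "P' \<subseteq> P" for P'
        using max[OF that(1)] that a(2) by blast
    qed (rule prime)
    then have min: "minimal_prime_over P (Idl (insert a Q))"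
      by (rule minimal_prime_over_genideal)
    have ideal: "ideal (Idl (insert a Q)) R"
      using ac ideal_props(1)[OF q(5)] by (intro genideal_ideal) blast
    \<comment> \<open>\<open>P\<close> is minimal over \<open>a\<close> and \<open>Q\<close>, so a
      power of each generator lies, up to a multiplier, in the ideal they generate. The component
      \<open>y\<close> in \<open>Q\<close> will replace \<open>g\<close>.\<close>
    have "\<exists>y\<in>Q. \<exists>t\<in>carrier R - P. \<exists>k::nat. \<exists>r\<in>carrier R. t \<otimes> g [^] k = r \<otimes> a \<oplus> y"
      if g: "g \<in> G" for g
    proof -
      obtain t k where t: "t \<in> carrier R - P" "t \<otimes> g [^] (k::nat) \<in> Idl (insert a Q)"
        using minimal_prime_over_nilpotent[OF min ideal] g GP by blast
      obtain r y where "r \<in> carrier R" "y \<in> Idl Q" "t \<otimes> g [^] k = r \<otimes> a \<oplus> y"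
        using genideal_insertE[OF ac ideal_props(1)[OF q(5)] t(2)] .
      then show ?thesis using t(1) genideal_minimal[OF q(5) order_refl] by blast
    qed
    then obtain y where y: "\<And>g. g \<in> G \<Longrightarrow> y g \<in> Q"
        "\<And>g. g \<in> G \<Longrightarrow> \<exists>t\<in>carrier R - P. \<exists>k::nat. \<exists>r\<in>carrier R. t \<otimes> g [^] k = r \<otimes> a \<oplus> y g"
      by metis
    define Y where "Y = y ` (G - {a})"
    have Y: "finite Y" "Y \<subseteq> Q" using Suc.prems(1) y(1) unfolding Y_def by auto
    have "card Y \<le> card (G - {a})" unfolding Y_def using Suc.prems(1) by (intro card_image_le) simp
    then have cardY: "card Y \<le> n" using Suc.prems(1,2) a(1) by simp
    \<comment> \<open>A prime inside \<open>P\<close> containing \<open>a\<close> and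
      \<open>Y\<close> contains a power of every generator, hence all of \<open>G\<close>.\<close>
    have minY: "minimal_prime_over P (insert a Y)"
      unfolding minimal_prime_over_def
    proof (intro conjI allI impI)
      show "insert a Y \<subseteq> P" using a(1) GP Q(3) Y(2) by blast
      fix P' assume P': "primeideal P' R" "insert a Y \<subseteq> P'" "P' \<subseteq> P"
      note p' = primeideal_complement[OF P'(1)] note pp' = ideal_props[OF p'(5)]
      have "g \<in> P'" if g: "g \<in> G" for g
      proof (cases "g = a")
        case False
        obtain t k r where t: "t \<in> carrier R - P" "r \<in> carrier R" "t \<otimes> g [^] (k::nat) = r \<otimes> a \<oplus> y g"
          using y(2)[OF g] by blast
        have gc: "g \<in> carrier R" using g GP ideal_props(7)[OF p(5)] by blast
        have "y g \<in> P'" "a \<in> P'" using P'(2) g False unfolding Y_def by auto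
        then have "t \<otimes> g [^] k \<in> P'" unfolding t(3) using t(2) pp'(3,4) by blast
        moreover have "t \<in> carrier R - P'" using t(1) P'(3) by blast
        ultimately have "g [^] k \<in> P'" using p'(3) gc by blast
        then show ?thesis using primeideal_nat_powD[OF P'(1) gc] by blast
      qed (use P'(2) in blast)
      then show "P' = P" using Suc.prems(3) P' unfolding minimal_prime_over_def by blast
    qed (rule prime)
    \<comment> \<open>By the principal ideal theorem for \<open>a\<close> modulo a prime over
      \<open>Y\<close>, no such prime lies strictly inside \<open>Q\<close>.\<close>
    have "minimal_prime_over Q Y"
      unfolding minimal_prime_over_def
      using Q(1) Y(2) krull_principal_ideal[OF minY Q(1,3)] by blast
    then have "m \<le> n"
      using Suc.IH[OF Y(1) cardY, of Q m] Suc.prems(4,5) Q(2) Suc by simp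
    then show ?thesis using Suc by simp
  qed simp
qed

end

section \<open>Equality of powers\<close>

context noetherian_cring
begin

text \<open>\<open>M / (M \<cdot> M)\<close> is a vector space over the field \<open>R / M\<close>,
  in which \<open>t\<close> is invertible: \<open>\<one>\<close> is an element of \<open>M\<close>
  plus a multiple of \<open>t\<close>.\<close>

lemma maximalideal_mem_cancel:
  assumes M: "maximalideal M R" and H: "ideal H R" "M \<cdot> M \<subseteq> H"
    and x: "x \<in> M" and t: "t \<in> carrier R - M" "t \<otimes> x \<in> H"
  shows "x \<in> H"
proof -
  have iM: "ideal M R" using M by (rule maximalideal.axioms)
  have tc: "t \<in> carrier R" using t by blast
  note m = ideal_props[OF iM] note h = ideal_props[OF H(1)]
  note it = cgenideal_ideal[OF tc]
  have "t \<in> M <+> PIdl t" "M \<subseteq> M <+> PIdl t"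
    using set_add_upper[OF iM it] cgenideal_self[OF tc] by auto
  then have "M <+> PIdl t = carrier R"
    using maximalideal.I_maximal[OF M add_ideals[OF iM it]] ideal_props(1)[OF add_ideals[OF iM it]] t(1)
    by blast
  then have "\<one> \<in> M <+> PIdl t" by simp
  then obtain y r where y: "y \<in> M" "r \<in> carrier R" "\<one> = y \<oplus> r \<otimes> t"
    unfolding mem_set_add cgenideal_def by blast
  have xc: "x \<in> carrier R" using x m by blast
  then have "x = \<one> \<otimes> x" by simp
  also have "\<dots> = y \<otimes> x \<oplus> r \<otimes> (t \<otimes> x)"
    unfolding y(3) using y(1,2) m(7) tc xc by (simp add: l_distr m_assoc)
  also have "\<dots> \<in> H"
    using ideal_prod.prod[OF y(1) x] H(2) t(2) y(2) h(3,4) by blast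
  finally show ?thesis .
qed

text \<open>\<open>G\<close> is only required to generate \<open>M\<close> after localization. The
  strict drop from \<open>card G\<close> to \<open>card Y\<close> is the source of the final
  contradiction with the height theorem.\<close>

lemma minimal_prime_over_of_ideal_pow_eq:
  assumes M: "maximalideal M R" and I: "ideal I R" "I \<subset> M"
    and n: "n \<ge> 1" "ideal_pow I n = ideal_pow M n"
    and G: "finite G" "G \<subseteq> M" "\<And>x. x \<in> M \<Longrightarrow> \<exists>t\<in>carrier R - M. t \<otimes> x \<in> Idl G"
  obtains Y where "finite Y" "card Y < card G" "minimal_prime_over M Y"
proof -
  have iM: "ideal M R" using M by (rule maximalideal.axioms)
  have prime: "primeideal M R" using M by (rule maximalideal_prime)
  note m = ideal_props[OF iM] note p = primeideal_complement[OF prime]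
  note iMM = ideal_prod_is_ideal[OF iM iM]
  note ipow = ideal_pow_ideal[OF iM]
  have MM: "M \<cdot> M \<subseteq> M" using ideal_prod_inter[OF iM iM] by blast
  obtain k where k: "n = Suc k" using n(1) by (cases n) auto
  have pow_I: "ideal_pow M n \<subseteq> I"
    unfolding n(2)[symmetric] unfolding k ideal_pow_Suc
    using ideal_prod_inter[OF ideal_pow_ideal[OF I(1)] I(1)] by blast
  define W where "W = (M \<cdot> M) <+> I"
  have iW: "ideal W R" unfolding W_def by (intro add_ideals iMM I(1))
  have WM: "W \<subseteq> M" unfolding W_def using MM I(2) by (intro set_add_least iM) auto
  have IW: "I \<subseteq> W" and MMW: "M \<cdot> M \<subseteq> W" unfolding W_def using set_add_upper[OF iMM I(1)] by auto
  \<comment> \<open>If \<open>W = M\<close>, Nakayama yields one \<open>t\<close> outside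
    \<open>M\<close> that multiplies \<open>M\<close> into \<open>I\<close>, so the ideals agree
    locally at \<open>M\<close>. Elsewhere they agree because \<open>I\<close> contains a power of
    \<open>M\<close>.\<close>
  have "W \<noteq> M"
  proof
    assume "W = M"
    then have "\<exists>t\<in>carrier R - M. t \<otimes> x \<in> (M \<cdot> M) <+> I" if "x \<in> M" for x
      using p(1) that m(7) unfolding W_def by (intro bexI[of _ \<one>]) auto
    then obtain t where t: "t \<in> carrier R - M" "\<And>x. x \<in> M \<Longrightarrow> t \<otimes> x \<in> I"
      using nakayama_ideal[OF prime I(1) iM] by blast
    have "x \<in> I" if x: "x \<in> M" for x
    proof -
      have xc: "x \<in> carrier R" using x m(7) by blast
      \<comment> \<open>A proper \<open>?K\<close> would lie in an associated prime
        \<open>N\<close>. As \<open>?K\<close> contains a power of \<open>M\<close>, this gives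
        \<open>N = M\<close>, although \<open>t\<close> is in \<open>?K\<close> and not in
        \<open>M\<close>.\<close>
      let ?K = "{r \<in> carrier R. x \<otimes> r \<in> I}"
      note iK = ideal.helper_max_prime[OF I(1) is_cring xc]
      have "?K = carrier R"
      proof (rule ccontr)
        assume "?K \<noteq> carrier R"
        then obtain s where s: "s \<in> carrier R - ?K" "primeideal {r \<in> carrier R. s \<otimes> r \<in> ?K} R"
          using ex_associated_prime[OF iK] by blast
        define N where "N = {r \<in> carrier R. s \<otimes> r \<in> ?K}"
        note primeN = s(2)[folded N_def]
        note iN = primeideal_complement(5)[OF primeN]
        have KN: "?K \<subseteq> N"
          unfolding N_def using ideal_props(4)[OF iK] s(1) by blast
        have "ideal_pow M n \<subseteq> ?K"
          using pow_I xc ideal_props(4,7)[OF I(1)] by auto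
        then have "M \<subseteq> N" using primeideal_ideal_powD[OF primeN iM] KN by blast
        then have "N = M"
          using maximalideal.I_maximal[OF M iN] primeideal_complement(1)[OF primeN]
            ideal_props(1)[OF iN] by blast
        moreover have "t \<in> ?K" using t(1) t(2)[OF x] xc by (simp add: m_comm[of x t])
        ultimately show False using KN t(1) by blast
      qed
      then have "\<one> \<in> ?K" by simp
      then show ?thesis using xc by simp
    qed
    then show False using I(2) by blast
  qed
  \<comment> \<open>A maximal member \<open>H\<close> corresponds to a hyperplane of
    \<open>M / (M \<cdot> M)\<close> through the image of \<open>I\<close>.\<close>
  then have "W \<in> {H. ideal H R \<and> W \<subseteq> H \<and> H \<subset> M}" using iW WM by blast
  then have "\<exists>H\<in>{H. ideal H R \<and> W \<subseteq> H \<and> H \<subset> M}.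
      \<forall>J\<in>{H. ideal H R \<and> W \<subseteq> H \<and> H \<subset> M}. H \<subseteq> J \<longrightarrow> J = H"
    by (intro ex_maximal_ideal_in) auto
  then obtain H where H': "H \<in> {H. ideal H R \<and> W \<subseteq> H \<and> H \<subset> M}"
      and max: "\<forall>J\<in>{H. ideal H R \<and> W \<subseteq> H \<and> H \<subset> M}. H \<subseteq> J \<longrightarrow> J = H" by (rule bexE)
  then have iH: "ideal H R" and WH: "W \<subseteq> H" and HM: "H \<subset> M" by auto
  note h = ideal_props[OF iH]
  have MMH: "M \<cdot> M \<subseteq> H" using MMW WH by blast
  have "\<not> G \<subseteq> H"
  proof
    assume "G \<subseteq> H"
    then have "Idl G \<subseteq> H" by (rule genideal_minimal[OF iH])
    then have "M \<subseteq> H"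
      using G(3) maximalideal_mem_cancel[OF M iH MMH] by blast
    then show False using HM by blast
  qed
  then obtain g where g: "g \<in> G" "g \<notin> H" by blast
  have gM: "g \<in> M" and gc: "g \<in> carrier R" using g(1) G(2) m(7) by auto
  note ig = cgenideal_ideal[OF gc]
  have "M = H <+> PIdl g"
  proof (rule ccontr)
    assume ne: "M \<noteq> H <+> PIdl g"
    have "H <+> PIdl g \<subseteq> M"
      using HM cgenideal_minimal[OF iM gM] by (intro set_add_least iM) auto
    moreover have up: "H \<subseteq> H <+> PIdl g" "g \<in> H <+> PIdl g"
      using set_add_upper[OF iH ig] cgenideal_self[OF gc] by auto
    ultimately have "H <+> PIdl g \<in> {H. ideal H R \<and> W \<subseteq> H \<and> H \<subset> M}"
      using ne WH add_ideals[OF iH ig] by blast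
    then have "H <+> PIdl g = H" using max up(1) by blast
    then show False using up(2) g(2) by blast
  qed
  \<comment> \<open>Subtracting a multiple of \<open>g\<close> moves every other generator into
    \<open>H\<close>; the corrected generators form \<open>Y\<close>.\<close>
  then have "\<forall>x\<in>G. \<exists>y\<in>H. \<exists>r\<in>carrier R. x = y \<oplus> r \<otimes> g"
    using G(2) unfolding set_add_def' cgenideal_def by blast
  then obtain y where y: "\<And>x. x \<in> G \<Longrightarrow> y x \<in> H"
      "\<And>x. x \<in> G \<Longrightarrow> \<exists>r\<in>carrier R. x = y x \<oplus> r \<otimes> g"
    by metis
  define Y where "Y = y ` (G - {g})"
  have Y: "finite Y" "Y \<subseteq> H" using G(1) y(1) unfolding Y_def by auto
  have Yc: "Y \<subseteq> carrier R" using Y(2) h(1) by blast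
  note iY = genideal_ideal[OF Yc]
  have IdlY: "Idl Y \<subseteq> H" by (rule genideal_minimal[OF iH Y(2)])
  have "card Y \<le> card (G - {g})" unfolding Y_def using G(1) by (intro card_image_le) simp
  also have "\<dots> < card G" using G(1) g(1) by (intro card_Diff1_less)
  finally have card: "card Y < card G" .
  have "G \<subseteq> Idl Y <+> PIdl g"
  proof
    fix x assume x: "x \<in> G"
    show "x \<in> Idl Y <+> PIdl g"
    proof (cases "x = g")
      case True
      then show ?thesis using set_add_upper(2)[OF iY ig] cgenideal_self[OF gc] by blast
    next
      case False
      then have "y x \<in> Idl Y" using x genideal_self[OF Yc] unfolding Y_def by blast
      then show ?thesis using y(2)[OF x] unfolding mem_set_add cgenideal_def by blast
    qed
  qed
  then have IdlG: "Idl G \<subseteq> Idl Y <+> PIdl g" by (intro genideal_minimal add_ideals iY ig)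
  define V where "V = Idl Y <+> (M \<cdot> M)"
  have iV: "ideal V R" unfolding V_def by (intro add_ideals iY iMM)
  have MMV: "M \<cdot> M \<subseteq> V" unfolding V_def using set_add_upper(2)[OF iY iMM] .
  \<comment> \<open>For an element of \<open>H\<close> the coefficient of \<open>g\<close> must lie
    in \<open>M\<close>, since \<open>g\<close> is outside \<open>H\<close>. The
    \<open>g\<close>-term therefore falls into \<open>M \<cdot> M\<close>.\<close>
  have HV: "H \<subseteq> V"
  proof
    fix x assume x: "x \<in> H"
    have xM: "x \<in> M" using x HM by blast
    obtain t where t: "t \<in> carrier R - M" "t \<otimes> x \<in> Idl G" using G(3)[OF xM] by blast
    then have "t \<otimes> x \<in> Idl Y <+> PIdl g" using IdlG by blast
    then obtain z r where z: "z \<in> Idl Y" "r \<in> carrier R" "t \<otimes> x = z \<oplus> r \<otimes> g"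
      unfolding mem_set_add cgenideal_def by blast
    have zH: "z \<in> H" using z(1) IdlY by blast
    have "r \<otimes> g = t \<otimes> x \<ominus> z"
      unfolding z(3) using z(2) gc h(7)[OF zH] by (simp add: add_diff_cancel)
    also have "\<dots> \<in> H" using h(6)[OF h(4)[OF _ x] zH] t(1) by blast
    finally have "r \<in> M" using maximalideal_mem_cancel[OF M iH MMH gM] g(2) z(2) by blast
    then have "t \<otimes> x \<in> V"
      unfolding V_def z(3) mem_set_add using z(1) ideal_prod.prod[OF _ gM] by blast
    then show "x \<in> V" by (rule maximalideal_mem_cancel[OF M iV MMV xM t(1)])
  qed
  \<comment> \<open>Only one of the \<open>n = Suc k\<close> factors \<open>I\<close> is placed in
    \<open>V\<close>, the others in \<open>M\<close>. The summand \<open>M \<cdot> M\<close> of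
    \<open>V\<close> then raises the exponent to \<open>n + 1\<close>, as Nakayama requires.\<close>
  have "ideal_pow M n \<subseteq> ideal_pow M k \<cdot> V"
    unfolding n(2)[symmetric] unfolding k ideal_pow_Suc
    using I(2) IW WH HV by (intro ideal_prod_mono ideal_pow_mono) auto
  also have "\<dots> = (ideal_pow M k \<cdot> (Idl Y)) <+> (ideal_pow M k \<cdot> (M \<cdot> M))"
    unfolding V_def by (rule ideal_prod_r_distr[OF ipow iY iMM])
  also have "ideal_pow M k \<cdot> (M \<cdot> M) = M \<cdot> ideal_pow M n"
    unfolding k ideal_pow_Suc ideal_prod_assoc[OF ipow iM iM, symmetric]
    by (rule ideal_prod_commute[OF ideal_prod_is_ideal[OF ipow iM] iM])
  also have "(ideal_pow M k \<cdot> (Idl Y)) <+> (M \<cdot> ideal_pow M n) \<subseteq> (M \<cdot> ideal_pow M n) <+> Idl Y"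
  proof (rule set_add_least)
    note i1 = ideal_prod_is_ideal[OF iM ipow]
    show "ideal ((M \<cdot> ideal_pow M n) <+> Idl Y) R" by (intro add_ideals i1 iY)
    show "M \<cdot> ideal_pow M n \<subseteq> (M \<cdot> ideal_pow M n) <+> Idl Y" by (rule set_add_upper(1)[OF i1 iY])
    show "ideal_pow M k \<cdot> (Idl Y) \<subseteq> (M \<cdot> ideal_pow M n) <+> Idl Y"
      using set_add_upper(2)[OF i1 iY] ideal_prod_inter[OF ipow iY] by blast
  qed
  finally have sub: "ideal_pow M n \<subseteq> (M \<cdot> ideal_pow M n) <+> Idl Y" .
  have "\<exists>t\<in>carrier R - M. t \<otimes> x \<in> (M \<cdot> ideal_pow M n) <+> Idl Y" if x: "x \<in> ideal_pow M n" for x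
    using p(1) subsetD[OF sub x] ideal_props(7)[OF ipow x] by (intro bexI[of _ \<one>]) auto
  then obtain t where t: "t \<in> carrier R - M" "\<And>x. x \<in> ideal_pow M n \<Longrightarrow> t \<otimes> x \<in> Idl Y"
    using nakayama_ideal[OF prime iY ipow] by blast
  have "minimal_prime_over M Y"
    unfolding minimal_prime_over_def
  proof (intro conjI allI impI)
    show "Y \<subseteq> M" using Y(2) HM by blast
    fix P assume P: "primeideal P R" "Y \<subseteq> P" "P \<subseteq> M"
    note c = primeideal_complement[OF P(1)]
    \<comment> \<open>The multiplier \<open>t\<close> is outside \<open>M\<close>, hence outside
      \<open>P\<close>, and can be cancelled.\<close>
    have "ideal_pow M n \<subseteq> P"
    proof
      fix x assume x: "x \<in> ideal_pow M n"
      have "t \<otimes> x \<in> P" using t(2)[OF x] genideal_minimal[OF c(5) P(2)] by blast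
      then show "x \<in> P" using c(3)[of t x] t(1) P(3) ideal_props(7)[OF ipow x] by blast
    qed
    then show "P = M" using primeideal_ideal_powD[OF P(1) iM] P(3) by blast
  qed (rule prime)
  then show thesis using that Y(1) card by blast
qed

end

section \<open>Passage to the localization\<close>

context cring
begin

context
  fixes P :: "'a set"
  assumes P: "primeideal P R"
begin

section \<open>Calculus of fractions, extension and contraction at a fixed prime\<close>

abbreviation "loc \<equiv> localization_at R P"
abbreviation "lfrac \<equiv> fraction R (carrier R - P)"

lemma submonoid_complement: "submonoid (carrier R - P) R"
  using primeideal_complement(1,2)[OF P] by unfold_locales auto

lemma loc_cring: "cring loc"
  using P by (rule primeideal.localization_at_cring)

lemma loc_one: "\<one>\<^bsub>loc\<^esub> = lfrac \<one> \<one>" and loc_zero: "\<zero>\<^bsub>loc\<^esub> = lfrac \<zero> \<one>"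
  by (simp_all add: localization_at_def fraction_ring_def)

lemma frac_closed: "a \<in> carrier R \<Longrightarrow> s \<in> carrier R - P \<Longrightarrow> lfrac a s \<in> carrier loc"
  unfolding localization_at_def by (rule fraction_in_carrier)

lemma locE:
  assumes "z \<in> carrier loc"
  obtains a s where "a \<in> carrier R" "s \<in> carrier R - P" "z = lfrac a s"
  using assms unfolding localization_at_def by (rule fraction_carrierE)

lemma frac_mult:
  assumes "a \<in> carrier R" "s \<in> carrier R - P" "b \<in> carrier R" "t \<in> carrier R - P"
  shows "lfrac a s \<otimes>\<^bsub>loc\<^esub> lfrac b t = lfrac (a \<otimes> b) (s \<otimes> t)"
  unfolding localization_at_def by (rule mult_fraction[OF submonoid_complement assms])

lemma frac_add:
  assumes "a \<in> carrier R" "s \<in> carrier R - P" "b \<in> carrier R" "t \<in> carrier R - P"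
  shows "lfrac a s \<oplus>\<^bsub>loc\<^esub> lfrac b t = lfrac (a \<otimes> t \<oplus> b \<otimes> s) (s \<otimes> t)"
  unfolding localization_at_def by (rule add_fraction[OF submonoid_complement assms])

lemma frac_eq_iff:
  assumes "a \<in> carrier R" "s \<in> carrier R - P" "b \<in> carrier R" "t \<in> carrier R - P"
  shows "lfrac a s = lfrac b t \<longleftrightarrow> (\<exists>u\<in>carrier R - P. u \<otimes> (a \<otimes> t) = u \<otimes> (b \<otimes> s))"
  by (rule fraction_eq_iff[OF submonoid_complement assms])

lemma frac_eqI:
  assumes "a \<in> carrier R" "s \<in> carrier R - P" "b \<in> carrier R" "t \<in> carrier R - P"
    and "a \<otimes> t = b \<otimes> s"
  shows "lfrac a s = lfrac b t"
  using frac_eq_iff[OF assms(1-4)] primeideal_complement(1)[OF P] assms(5) by metis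

lemma frac_mult_inverse:
  assumes "a \<in> carrier R - P" "s \<in> carrier R - P"
  shows "lfrac s a \<otimes>\<^bsub>loc\<^esub> lfrac a s = \<one>\<^bsub>loc\<^esub>"
proof -
  note p = primeideal_complement[OF P]
  have "lfrac (s \<otimes> a) (a \<otimes> s) = lfrac \<one> \<one>"
    using assms p(1) p(2)[OF assms] by (intro frac_eqI) (auto simp: m_comm)
  then show ?thesis using assms by (simp add: frac_mult loc_one)
qed

lemma frac_hom: "ring_hom_ring R loc (\<lambda>x. lfrac x \<one>)"
proof (rule ring_hom_ringI)
  note p = primeideal_complement[OF P]
  show "ring loc" using loc_cring by (rule cring.axioms)
  show "lfrac (x \<otimes> y) \<one> = lfrac x \<one> \<otimes>\<^bsub>loc\<^esub> lfrac y \<one>"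
    and "lfrac (x \<oplus> y) \<one> = lfrac x \<one> \<oplus>\<^bsub>loc\<^esub> lfrac y \<one>"
    if "x \<in> carrier R" "y \<in> carrier R" for x y
    using that p(1) by (simp_all add: frac_mult frac_add)
qed (use primeideal_complement(1)[OF P] in \<open>auto simp: ring_axioms loc_one frac_closed\<close>)

definition loc_extension :: "'a set \<Rightarrow> ('a \<times> 'a) set set"
  where "loc_extension A = {lfrac a s | a s. a \<in> A \<and> s \<in> carrier R - P}"

lemma loc_extension_ideal:
  assumes A: "ideal A R"
  shows "ideal (loc_extension A) loc"
proof (rule cring.idealI_cring[OF loc_cring])
  note p = primeideal_complement[OF P] note a = ideal_props[OF A]
  show "loc_extension A \<subseteq> carrier loc"
    unfolding loc_extension_def using a(7) frac_closed by blast
  show "\<zero>\<^bsub>loc\<^esub> \<in> loc_extension A"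
    unfolding loc_extension_def loc_zero using a(2) p(1) by blast
  show "x \<oplus>\<^bsub>loc\<^esub> y \<in> loc_extension A"
    if xy: "x \<in> loc_extension A" "y \<in> loc_extension A" for x y
  proof -
    obtain b s where b: "b \<in> A" "s \<in> carrier R - P" "x = lfrac b s"
      using xy(1) unfolding loc_extension_def by blast
    obtain c t where c: "c \<in> A" "t \<in> carrier R - P" "y = lfrac c t"
      using xy(2) unfolding loc_extension_def by blast
    have "x \<oplus>\<^bsub>loc\<^esub> y = lfrac (b \<otimes> t \<oplus> c \<otimes> s) (s \<otimes> t)"
      unfolding b(3) c(3) using a(7) b c by (intro frac_add)
    moreover have "b \<otimes> t \<oplus> c \<otimes> s \<in> A" using b c a(3,5) by auto
    ultimately show ?thesis unfolding loc_extension_def using p(2)[OF b(2) c(2)] by blast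
  qed
  show "z \<otimes>\<^bsub>loc\<^esub> x \<in> loc_extension A" if zx: "z \<in> carrier loc" "x \<in> loc_extension A" for z x
  proof -
    obtain b s where b: "b \<in> carrier R" "s \<in> carrier R - P" "z = lfrac b s"
      using zx(1) by (rule locE)
    obtain c t where c: "c \<in> A" "t \<in> carrier R - P" "x = lfrac c t"
      using zx(2) unfolding loc_extension_def by blast
    have "z \<otimes>\<^bsub>loc\<^esub> x = lfrac (b \<otimes> c) (s \<otimes> t)"
      unfolding b(3) c(3) using a(7) b c by (intro frac_mult)
    moreover have "b \<otimes> c \<in> A" using b c a(4) by auto
    ultimately show ?thesis unfolding loc_extension_def using p(2)[OF b(2) c(2)] by blast
  qed
qed

text \<open>Clearing denominators in an equality of fractions gives membership only up to a
  multiplier, the form in which local generation is used above.\<close>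

lemma mem_loc_extensionD:
  assumes A: "ideal A R" and x: "x \<in> carrier R" "s \<in> carrier R - P" "lfrac x s \<in> loc_extension A"
  shows "\<exists>t\<in>carrier R - P. t \<otimes> x \<in> A"
proof -
  note p = primeideal_complement[OF P] note a = ideal_props[OF A]
  obtain b t where b: "b \<in> A" "t \<in> carrier R - P" "lfrac x s = lfrac b t"
    using x(3) unfolding loc_extension_def by blast
  have bc: "b \<in> carrier R" using a(7) b(1) .
  obtain u where u: "u \<in> carrier R - P" "u \<otimes> (x \<otimes> t) = u \<otimes> (b \<otimes> s)"
    using frac_eq_iff[OF x(1,2) bc b(2)] b(3) by blast
  have "(u \<otimes> t) \<otimes> x = u \<otimes> (x \<otimes> t)" using u(1) b(2) x(1) by (simp add: m_ac)
  also have "\<dots> \<in> A" unfolding u(2) using u(1) x(2) b(1) a(4,5) by auto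
  finally show ?thesis using p(2)[OF u(1) b(2)] by blast
qed

text \<open>A fraction outside the extension has its numerator outside \<open>P\<close>, so the
  inverted fraction is its inverse.\<close>

lemma loc_extension_maximalideal: "maximalideal (loc_extension P) loc"
proof (rule maximalidealI)
  note p = primeideal_complement[OF P]
  show "ideal (loc_extension P) loc" using p(5) by (rule loc_extension_ideal)
  show "carrier loc \<noteq> loc_extension P"
  proof
    assume "carrier loc = loc_extension P"
    then have "lfrac \<one> \<one> \<in> loc_extension P" using p(1) frac_closed by blast
    then show False using mem_loc_extensionD[OF p(5) _ p(1)] p(3) p(1) by blast
  qed
  show "J = loc_extension P \<or> J = carrier loc"
    if J: "ideal J loc" "loc_extension P \<subseteq> J" "J \<subseteq> carrier loc" for J
  proof (rule disjCI)
    assume "J \<noteq> carrier loc"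
    have "z \<in> loc_extension P" if z: "z \<in> J" for z
    proof (rule ccontr)
      assume notin: "z \<notin> loc_extension P"
      obtain a s where a: "a \<in> carrier R" "s \<in> carrier R - P" "z = lfrac a s"
        using locE z J(3) by blast
      then have "a \<in> carrier R - P" using notin unfolding loc_extension_def by blast
      then have "\<one>\<^bsub>loc\<^esub> = lfrac s a \<otimes>\<^bsub>loc\<^esub> z" "lfrac s a \<in> carrier loc"
        unfolding a(3) using frac_mult_inverse a(2) frac_closed by auto
      then have "\<one>\<^bsub>loc\<^esub> \<in> J" using ideal.I_l_closed[OF J(1) z] by simp
      then show False using ideal.one_imp_carrier[OF J(1)] \<open>J \<noteq> carrier loc\<close> by blast
    qed
    then show "J = loc_extension P" using J(2) by blast
  qed
qed

definition loc_contraction :: "('a \<times> 'a) set set \<Rightarrow> 'a set"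
  where "loc_contraction Q = {x \<in> carrier R. lfrac x \<one> \<in> Q}"

lemma loc_contraction_primeideal: "primeideal Q loc \<Longrightarrow> primeideal (loc_contraction Q) R"
  unfolding loc_contraction_def by (rule ring_hom_ring.primeideal_vimage[OF frac_hom is_cring])

lemma loc_contraction_subset:
  assumes Q: "primeideal Q loc"
  shows "loc_contraction Q \<subseteq> P"
proof (rule subsetI, rule ccontr)
  note p = primeideal_complement[OF P]
  have iQ: "ideal Q loc" using Q by (rule primeideal.axioms)
  fix x assume x: "x \<in> loc_contraction Q" "x \<notin> P"
  then have xc: "x \<in> carrier R - P" "lfrac x \<one> \<in> Q" unfolding loc_contraction_def by auto
  then have "\<one>\<^bsub>loc\<^esub> = lfrac \<one> x \<otimes>\<^bsub>loc\<^esub> lfrac x \<one>" "lfrac \<one> x \<in> carrier loc"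
    using frac_mult_inverse p(1) frac_closed by auto
  then have "\<one>\<^bsub>loc\<^esub> \<in> Q" using ideal.I_l_closed[OF iQ xc(2)] by simp
  then show False using ideal.one_imp_carrier[OF iQ] primeideal.I_notcarr[OF Q] by blast
qed

text \<open>Every fraction is a unit multiple of the image of its numerator, so an ideal of the
  localization is determined by its contraction.\<close>

lemma loc_contraction_strict_mono:
  assumes Q: "ideal Q loc" and Q': "ideal Q' loc" and less: "Q \<subset> Q'"
  shows "loc_contraction Q \<subset> loc_contraction Q'"
proof -
  note p = primeideal_complement[OF P]
  obtain z where z: "z \<in> Q'" "z \<notin> Q" using less by blast
  then have "z \<in> carrier loc" using ideal.Icarr[OF Q'] by blast
  then obtain a s where a: "a \<in> carrier R" "s \<in> carrier R - P" "z = lfrac a s" by (rule locE)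
  have one: "\<one> \<in> carrier R - P" and sc: "s \<in> carrier R" using p(1) a(2) by auto
  have ss: "\<one> \<otimes> s \<in> carrier R - P" "s \<otimes> \<one> \<in> carrier R - P" using a(2) by auto
  have "lfrac s \<one> \<otimes>\<^bsub>loc\<^esub> z = lfrac (s \<otimes> a) (\<one> \<otimes> s)"
    unfolding a(3) by (rule frac_mult[OF sc one a(1,2)])
  also have "\<dots> = lfrac a \<one>" using a(1,2) one ss by (intro frac_eqI) (auto simp: m_comm)
  finally have "lfrac a \<one> \<in> Q'" using ideal.I_l_closed[OF Q' z(1) frac_closed[OF sc one]] by simp
  moreover have "lfrac a \<one> \<notin> Q"
  proof
    assume "lfrac a \<one> \<in> Q"
    then have "lfrac \<one> s \<otimes>\<^bsub>loc\<^esub> lfrac a \<one> \<in> Q"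
      by (rule ideal.I_l_closed[OF Q]) (use frac_closed a(2) in simp)
    also have "lfrac \<one> s \<otimes>\<^bsub>loc\<^esub> lfrac a \<one> = lfrac (\<one> \<otimes> a) (s \<otimes> \<one>)"
      by (rule frac_mult[OF one_closed a(2) a(1) one])
    also have "\<dots> = z" unfolding a(3) using a(1,2) by simp
    finally show False using z(2) by blast
  qed
  ultimately show ?thesis unfolding loc_contraction_def using less a(1) by blast
qed

end

end

section \<open>Dimension and generators of the localization\<close>

context noetherian_cring
begin

text \<open>Contraction turns a chain of primes of the localization into one of equal length inside
  \<open>P\<close>, to which \<open>krull_height\<close> applies.\<close>

lemma krull_dim_localization_le:
  assumes P: "minimal_prime_over P G" "finite G"
  shows "krull_dim (localization_at R P) \<le> enat (card G)"
  unfolding krull_dim_def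
proof (rule Sup_least)
  have prime: "primeideal P R" using P(1) by (simp add: minimal_prime_over_def)
  let ?L = "localization_at R P"
  fix x assume "x \<in> {enat n |n. \<exists>C. (\<forall>i\<le>n. primeideal (C i) ?L) \<and> (\<forall>i<n. C i \<subset> C (Suc i))}"
  then obtain n C where x: "x = enat n" and C: "\<And>i. i \<le> n \<Longrightarrow> primeideal (C i) ?L"
      "\<And>i. i < n \<Longrightarrow> C i \<subset> C (Suc i)" by blast
  have "n \<le> card G"
  proof (rule krull_height[OF P(2) order_refl P(1)])
    let ?C = "\<lambda>i. loc_contraction P (C i)"
    show "primeideal (?C i) R" if "i \<le> n" for i
      using loc_contraction_primeideal[OF prime C(1)[OF that]] .
    show "?C i \<subset> ?C (Suc i)" if "i < n" for i
      using that C by (intro loc_contraction_strict_mono[OF prime] primeideal.axioms(1)) auto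
    show "?C n \<subseteq> P" using loc_contraction_subset[OF prime C(1)] by simp
  qed
  then show "x \<le> enat (card G)" unfolding x by simp
qed

text \<open>\<open>G\<close> consists of numerators of a smallest generating set of the maximal
  ideal of the localization, whose size regularity makes equal to the dimension. Numerators may
  coincide, hence the inequality.\<close>

lemma ex_local_generators:
  assumes P: "primeideal P R" and loc: "regular_local_ring (localization_at R P)"
  obtains G where "finite G" "G \<subseteq> P" "enat (card G) \<le> krull_dim (localization_at R P)"
    "\<And>x. x \<in> P \<Longrightarrow> \<exists>t\<in>carrier R - P. t \<otimes> x \<in> Idl G"
proof -
  let ?L = "localization_at R P" let ?m = "loc_extension P P"
  interpret L: regular_local_ring ?L by (rule loc)
  note p = primeideal_complement[OF P]
  note max = loc_extension_maximalideal[OF P]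
  have im: "ideal ?m ?L" using max by (rule maximalideal.axioms)
  let ?S = "{enat (card G) | G. G \<subseteq> carrier ?L \<and> finite G \<and> ?m = Idl\<^bsub>?L\<^esub> G}"
  \<comment> \<open>The localization is Noetherian, so the infimum over a nonempty set in
    \<open>enat\<close> is attained by an actual finite set \<open>B\<close>.\<close>
  have "?S \<noteq> {}" using L.finetely_gen[OF im] by blast
  then have "Inf ?S \<in> ?S" unfolding Inf_enat_def by (simp only: if_False) (metis (lifting) LeastI equals0I)
  then obtain B where B: "B \<subseteq> carrier ?L" "finite B" "?m = Idl\<^bsub>?L\<^esub> B"
      and card_B: "enat (card B) = Inf ?S" by (smt (verit) mem_Collect_eq)
  have "enat (card B) = krull_dim ?L"
    unfolding card_B using L.regular[OF max] by (simp add: min_num_gens_def)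
  have Bm: "B \<subseteq> ?m" unfolding B(3) using L.genideal_self[OF B(1)] .
  then have "\<forall>z\<in>B. \<exists>a\<in>P. \<exists>s\<in>carrier R - P. z = fraction R (carrier R - P) a s"
    unfolding loc_extension_def[OF P] by blast
  then obtain a where a: "\<And>z. z \<in> B \<Longrightarrow> a z \<in> P"
      "\<And>z. z \<in> B \<Longrightarrow> \<exists>s\<in>carrier R - P. z = fraction R (carrier R - P) (a z) s" by metis
  let ?G = "a ` B"
  have GP: "?G \<subseteq> P" using a(1) by blast
  then have Gc: "?G \<subseteq> carrier R" using ideal_props(1)[OF p(5)] by blast
  note iG = genideal_ideal[OF Gc]
  have "B \<subseteq> loc_extension P (Idl ?G)"
  proof
    fix z assume z: "z \<in> B"
    then have "a z \<in> Idl ?G" using genideal_self[OF Gc] by blast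
    then show "z \<in> loc_extension P (Idl ?G)"
      using a(2)[OF z] unfolding loc_extension_def[OF P] by blast
  qed
  then have m: "?m \<subseteq> loc_extension P (Idl ?G)"
    unfolding B(3) by (intro L.genideal_minimal loc_extension_ideal[OF P] iG)
  show thesis
  proof (rule that)
    show "finite ?G" using B(2) by simp
    show "?G \<subseteq> P" by (rule GP)
    show "enat (card ?G) \<le> krull_dim ?L"
      using card_image_le[OF B(2), of a] \<open>enat (card B) = krull_dim ?L\<close> by (metis enat_ord_simps(1))
    fix x assume x: "x \<in> P"
    then have "fraction R (carrier R - P) x \<one> \<in> ?m"
      using p(1) unfolding loc_extension_def[OF P] by blast
    then show "\<exists>t\<in>carrier R - P. t \<otimes> x \<in> Idl ?G"
      using mem_loc_extensionD[OF P iG _ p(1)] m ideal_props(7)[OF p(5) x] by blast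
  qed
qed

end

theorem theorem8p3:
  fixes R :: "('a, 'b) ring_scheme" and M :: "'a set"
  assumes "regular_ring R"
    and "maximalideal M R"
  shows "big_ideal M R"
proof -
  interpret regular_ring R by (rule assms(1))
  interpret noetherian_cring R ..
  note M = assms(2)
  have iM: "ideal M R" using M by (rule maximalideal.axioms)
  have prime: "primeideal M R" using M by (rule maximalideal_prime)
  obtain G where G: "finite G" "G \<subseteq> M" "enat (card G) \<le> krull_dim (localization_at R M)"
    "\<And>x. x \<in> M \<Longrightarrow> \<exists>t\<in>carrier R - M. t \<otimes>\<^bsub>R\<^esub> x \<in> Idl\<^bsub>R\<^esub> G"
    using ex_local_generators[OF prime localizations_regular[OF prime]] by blast
  show ?thesis
    unfolding big_ideal_def
  proof (intro conjI allI impI iM)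
    fix I and n :: nat
    assume I: "ideal I R \<and> I \<subset> M" and n: "n \<ge> 1"
    \<comment> \<open>Inclusion of the powers is monotonicity. Equality would bound the dimension by
      \<open>card Y\<close>, below \<open>card G\<close>, which is at most the dimension.\<close>
    have "ideal_pow I n \<noteq> ideal_pow M n"
    proof
      assume "ideal_pow I n = ideal_pow M n"
      then obtain Y where "finite Y" "card Y < card G" "minimal_prime_over M Y"
        using minimal_prime_over_of_ideal_pow_eq[OF M _ _ n _ G(1,2,4)] I by blast
      then have "krull_dim (localization_at R M) < enat (card G)"
        using krull_dim_localization_le by (meson enat_ord_simps(2) le_less_trans)
      then show False using G(3) by simp
    qed
    then show "ideal_pow I n \<subset> ideal_pow M n"
      using ideal_pow_mono[of I M n] I by blast
  qed
qed

end
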